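(* Away from the singular set $(\mathfrak X_{\rm CR}\cup\mathfrak X_{\rm CR}^* )\cap\mathfrak X^*$, the pseudoconformal manifold $(\mathfrak X^*,I,J)$ is strictly pseudoconformal (spsc). Moreover, the ${\rm CR}$ submanifold structure of $(\mathfrak X^*,I,J)$ induced by its strict pseudoconformality (its horizontal and vertical bundles) coincides with the antiholomorphic ${\rm CR}$ submanifold structure $(\mathcal H,\mathcal V)$, $\mathcal V=\mathcal T_*(\mathcal H)$, inherited from $\mathbb C^3$.
   Context: Cross-ratio variety: $\mathfrak X$ is the set of $(\mathbb X_1,\mathbb X_2,\mathbb X_3)\in\mathbb C^3$ with $|\mathbb X_3|^2=|\mathbb X_2|^2/|\mathbb X_1|^2$ and $2|\mathbb X_1|^2\Re(\mathbb X_3)=|\mathbb X_1|^2+|\mathbb X_2|^2-2\Re(\mathbb X_1)-2\Re(\mathbb X_2)+1$. Put $\mathfrak X^*=\{(\mathbb X_1,\mathbb X_2,\mathbb X_3)\in\mathfrak X:\Im(\mathbb X_3)\neq0\}$ (a smooth real 4-dimensional submanifold of $\mathbb C^3$), $\mathfrak X^*_{\pm}=\{\pm\Im(\mathbb X_3)>0\}\subset\mathfrak X^*$, $$\mathfrak X_{\rm CR}=\{(\mathbb X_1,\mathbb X_2,\mathbb X_3)\in\mathfrak X:\ \mathbb X_1+\mathbb X_2=1,\ 1/\mathbb X_2+1/\mathbb X_3=1,\ \mathbb X_3+1/\mathbb X_1=1\},$$ and let $\mathfrak X_{\rm CR}^*=\mathcal T(\mathfrak X_{\rm CR})$, where $\mathcal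 T:\mathfrak X\to\mathfrak X$ is the involution $\mathcal T(\mathbb X_1,\mathbb X_2,\mathbb X_3)=(\mathbb X_1,\mathbb X_2,\overline{\mathbb X_3})$. Complex structure $I$ on $\mathfrak X^*$: given by the two non-overlapping charts $(\mathfrak X^*_\pm,\mathcal M_\pm)$, $\mathcal M_\pm(\mathbb X_1,\mathbb X_2,\mathbb X_3)=(\mathbb X_1,\mathbb X_2)\in\mathbb C^2$. Complex structure $J$ on $\mathfrak X^*$: the one making the homeomorphism $\mathcal N:\mathfrak X^*\to\mathbb CP^1\times(\mathbb C\setminus\mathbb R)$ a biholomorphism, where $\mathcal N(\mathbb X_1,\mathbb X_2,\mathbb X_3)=([z_1:z_4],\mathbb X_3)$. Here $[z_1:z_4]=[\mathbb X_1+\mathbb X_2/\mathbb X_3:\mathbb X_1+\mathbb X_2-1]$ when these two entries are not both zero, and $[z_1:z_4]=[0:1]$ when both are zero (which happens exactly on $\mathfrak X_{\rm CR}\cap \mathfrak X^*$). Psc manifold $(M,I,J)$: a real 4-manifold $M$ with complex structures $I,J$ such that there is a complex 1-dimensional subbundle $\mathcal H^{(1,0)}(M,I)\subset T^{(1,0)}(M,I)$ with $({\rm id})_*\mathcal H^{(1,0)}(M,I)\subset T^{(1,0)}(M,J)$, ${\rm id}:(M,I)\to(M,J)$, maximal in terms of dimension and uniqueness (any subbundle of $T^{(1,0)}(M,I)$ mapped into $T^{(1,0)}(M,J)$ equals it). Its underlying real rank 2 bundle $\mathcal H(M)$ is the horizontal bundle. Spsc manifold: a psc manifold with, in addition, a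 complex 1-dimensional subbundle $\mathcal V^{(1,0)}(M,I)\subset T^{(1,0)}(M,I)$ such that $T^{(1,0)}(M,I)=\mathcal H^{(1,0)}(M,I)\oplus\mathcal V^{(1,0)}(M,I)$ and ${\rm id}_*\mathcal V^{(1,0)}(M,I)$ is a complex 1-dimensional subbundle of $T^{(0,1)}(M,J)$. Its underlying real bundle $\mathcal V(M)$ is the vertical bundle. Thus $I\equiv J$ on $\mathcal H(M)$ and $I\equiv-J$ on $\mathcal V(M)$. Structure from $\mathbb C^3$: with $\mathbb J$ the complex structure of $\mathbb C^3$, on $\mathfrak X\setminus\mathfrak X_{\rm CR}$ let $\mathcal H=T\cap\mathbb JT$ ($T$ the tangent bundle). Then $\mathcal H^{(1,0)}=\{X-i\mathbb JX:X\in\mathcal H\}$ is generated by $Z=D_{\zeta_2,\zeta_3}\partial_{\zeta_1}+D_{\zeta_3,\zeta_1}\partial_{\zeta_2}+D_{\zeta_1,\zeta_2}\partial_{\zeta_3}$, where $D_{\zeta_2,\zeta_3}=\frac{|\zeta_2|^2}{|\zeta_3|^2}(\overline{\zeta_2}\,\overline{\zeta_3}-\overline{\zeta_2}-\overline{\zeta_3})$, $D_{\zeta_3,\zeta_1}=\overline{\zeta_3}|\zeta_1|^2(1+\overline{\zeta_1}\,\overline{\zeta_3}-\overline{\zeta_1})$, $D_{\zeta_1,\zeta_2}=\frac{\overline{\zeta_2}}{\zeta_1}(1-\overline{\zeta_1}-\overline{\zeta_2})$. The bundle $\mathcal V=\mathcal T_*(\mathcal H)$ is spanned by the real and imaginary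 parts of $W=\mathcal T_*(Z)$. A ${\rm CR}$ submanifold $M$ of a complex manifold $(N,\mathbb J)$ with ${\rm CR}$ bundle $\mathcal H=T(M)\cap\mathbb JT(M)$ is antiholomorphic if $T(M)=\mathcal H\oplus\mathcal V$ for a subbundle $\mathcal V$ with $\mathbb J\mathcal V\cap T(M)=\{0\}$. *)

theory Defs
  imports "HOL-Analysis.Analysis"
begin

section \<open>Smooth maps and embedded submanifolds of Euclidean space\<close>

text \<open>
  Being of class \<open>C\<^sup>k\<close> on an open set \<open>S\<close>; in finite dimension it suffices to ask that all
  directional derivatives \<open>x \<mapsto> f' x v\<close> are of class \<open>C\<^sup>k\<^sup>-\<^sup>1\<close>.
\<close>

primrec Ck_on :: "nat \<Rightarrow> 'a::euclidean_space set \<Rightarrow> ('a \<Rightarrow> 'b::real_normed_vector) \<Rightarrow> bool" where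
  "Ck_on 0 S f \<longleftrightarrow> continuous_on S f"
| "Ck_on (Suc k) S f \<longleftrightarrow>
     (\<exists>f'. (\<forall>x\<in>S. (f has_derivative f' x) (at x)) \<and> (\<forall>v. Ck_on k S (\<lambda>x. f' x v)))"

definition smooth_on :: "'a::euclidean_space set \<Rightarrow> ('a \<Rightarrow> 'b::real_normed_vector) \<Rightarrow> bool" where
  "smooth_on S f \<longleftrightarrow> open S \<and> (\<forall>k. Ck_on k S f)"

text \<open>On an arbitrary subset, smooth means: locally the restriction of a smooth map.\<close>

definition smooth_map_on :: "'a::euclidean_space set \<Rightarrow> ('a \<Rightarrow> 'b::real_normed_vector) \<Rightarrow> bool" where
  "smooth_map_on S f \<longleftrightarrow>
     (\<forall>p\<in>S. \<exists>U g. p \<in> U \<and> smooth_on U g \<and> (\<forall>q\<in>S \<inter> U. g q = f q))"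

text \<open>
  Embedded smooth submanifolds of real dimension \<open>d\<close>, by local defining functions with linearly
  independent differentials.
\<close>

definition smooth_submanifold :: "nat \<Rightarrow> 'a::euclidean_space set \<Rightarrow> bool" where
  "smooth_submanifold d M \<longleftrightarrow> d \<le> DIM('a) \<and>
     (\<forall>p\<in>M. \<exists>U (f :: nat \<Rightarrow> 'a \<Rightarrow> real). p \<in> U \<and>
        open U \<and> (\<forall>i<DIM('a) - d. smooth_on U (f i)) \<and>
        M \<inter> U = {x\<in>U. \<forall>i<DIM('a) - d. f i x = 0} \<and>
        (\<forall>c. (\<forall>v. (\<Sum>i<DIM('a) - d. c i * frechet_derivative (f i) (at p) v) = 0)
              \<longrightarrow> (\<forall>i<DIM('a) - d. c i = 0)))"

definition tangent_space :: "'a::euclidean_space set \<Rightarrow> 'a \<Rightarrow> 'a set" where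
  "tangent_space M p = {v. \<exists>e>0. \<exists>\<gamma>. smooth_on {-e<..<e} \<gamma> \<and> \<gamma> ` {-e<..<e} \<subseteq> M \<and>
                              \<gamma> 0 = p \<and> (\<gamma> has_vector_derivative v) (at (0::real))}"


section \<open>Complex structures on real 4-manifolds\<close>

text \<open>
  A complex structure is given by a holomorphic atlas with values in \<open>\<complex>\<^sup>2\<close>; a chart is a pair of
  a domain and a map. The charts are required to be diffeomorphisms for the smooth
  structure that \<open>M\<close> has as a submanifold, so that \<open>M\<close> is the underlying real manifold.
\<close>

type_synonym 'a chart = "'a set \<times> ('a \<Rightarrow> complex^2)"

definition holomorphic_map_on :: "(complex^'n) set \<Rightarrow> (complex^'n \<Rightarrow> complex^'m) \<Rightarrow> bool" where
  "holomorphic_map_on S f \<longleftrightarrow>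
     (\<forall>x\<in>S. \<exists>D. (f has_derivative D) (at x) \<and> (\<forall>c v. D (c *s v) = c *s D v))"

definition complex_structure :: "'a::euclidean_space set \<Rightarrow> 'a chart set \<Rightarrow> bool" where
  "complex_structure M A \<longleftrightarrow>
     (\<Union>(U, \<phi>)\<in>A. U) = M \<and>
     (\<forall>(U, \<phi>)\<in>A. openin (top_of_set M) U \<and> inj_on \<phi> U \<and> open (\<phi> ` U) \<and>
                 smooth_map_on U \<phi> \<and> smooth_on (\<phi> ` U) (inv_into U \<phi>)) \<and>
     (\<forall>(U, \<phi>)\<in>A. \<forall>(U', \<phi>')\<in>A. holomorphic_map_on (\<phi> ` (U \<inter> U')) (\<phi>' \<circ> inv_into U \<phi>))"

definition restrict_atlas :: "'a chart set \<Rightarrow> 'a set \<Rightarrow> 'a chart set" where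
  "restrict_atlas A S = (\<lambda>(U, \<phi>). (U \<inter> S, \<phi>)) ` A"

definition pullback_atlas :: "('a \<Rightarrow> 'b) \<Rightarrow> 'a set \<Rightarrow> 'b chart set \<Rightarrow> 'a chart set" where
  "pullback_atlas f S A = (\<lambda>(U, \<phi>). (S \<inter> f -` U, \<phi> \<circ> f)) ` A"

text \<open>
  The induced complex structure on the tangent space at \<open>p\<close>: multiplication by \<open>\<i>\<close> in a chart.
  The derivative within the chart domain need not be unique as a linear map on the
  ambient space, but it is unique on tangent vectors.
\<close>

definition tangent_cs :: "'a::euclidean_space set \<Rightarrow> 'a chart set \<Rightarrow> 'a \<Rightarrow> 'a \<Rightarrow> 'a" where
  "tangent_cs M A p X =
     (THE Y. Y \<in> tangent_space M p \<and>
        (\<exists>(U, \<phi>)\<in>A. p \<in> U \<and>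
           (\<exists>D. (\<phi> has_derivative D) (at p within U) \<and> D Y = \<i> *s D X)))"

text \<open>A complexified tangent vector \<open>X + \<i> Y\<close> is represented by the pair \<open>(X, Y)\<close>.\<close>

definition cscale :: "complex \<Rightarrow> 'a::real_vector \<times> 'a \<Rightarrow> 'a \<times> 'a" where
  "cscale c w = (Re c *\<^sub>R fst w - Im c *\<^sub>R snd w, Re c *\<^sub>R snd w + Im c *\<^sub>R fst w)"

text \<open>\<open>T10 M A p = {X - \<i> I X}\<close> and \<open>T01 M A p = {X + \<i> I X}\<close>, where \<open>I\<close> is induced by \<open>A\<close>.\<close>

definition T10 :: "'a::euclidean_space set \<Rightarrow> 'a chart set \<Rightarrow> 'a \<Rightarrow> ('a \<times> 'a) set" where
  "T10 M A p = {(X, - tangent_cs M A p X) | X. X \<in> tangent_space M p}"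

definition T01 :: "'a::euclidean_space set \<Rightarrow> 'a chart set \<Rightarrow> 'a \<Rightarrow> ('a \<times> 'a) set" where
  "T01 M A p = {(X, tangent_cs M A p X) | X. X \<in> tangent_space M p}"


section \<open>Subbundles\<close>

text \<open>
  Families of subspaces indexed by the points of \<open>M\<close> which locally have a smooth frame
  of length \<open>r\<close>.
\<close>

definition complex_subbundle ::
    "nat \<Rightarrow> 'a::euclidean_space set \<Rightarrow> ('a \<Rightarrow> ('a \<times> 'a) set) \<Rightarrow> bool" where
  "complex_subbundle r M B \<longleftrightarrow>
     (\<forall>p\<in>M. \<exists>U s. p \<in> U \<and> open U \<and> (\<forall>i<r. smooth_on U (s i)) \<and>
        (\<forall>q\<in>M \<inter> U. B q = range (\<lambda>c. \<Sum>i<r. cscale (c i) (s i q)) \<and>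
           (\<forall>c. (\<Sum>i<r. cscale (c i) (s i q)) = 0 \<longrightarrow> (\<forall>i<r. c i = 0))))"

definition real_subbundle ::
    "nat \<Rightarrow> 'a::euclidean_space set \<Rightarrow> ('a \<Rightarrow> 'a set) \<Rightarrow> bool" where
  "real_subbundle r M B \<longleftrightarrow>
     (\<forall>p\<in>M. \<exists>U s. p \<in> U \<and> open U \<and> (\<forall>i<r. smooth_on U (s i)) \<and>
        (\<forall>q\<in>M \<inter> U. B q = range (\<lambda>c::nat \<Rightarrow> real. \<Sum>i<r. c i *\<^sub>R s i q) \<and>
           (\<forall>c::nat \<Rightarrow> real. (\<Sum>i<r. c i *\<^sub>R s i q) = 0 \<longrightarrow> (\<forall>i<r. c i = 0))))"

definition is_direct_sum :: "'v::real_vector set \<Rightarrow> 'v set \<Rightarrow> 'v set \<Rightarrow> bool" where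
  "is_direct_sum T B C \<longleftrightarrow> T = {b + c | b c. b \<in> B \<and> c \<in> C} \<and> B \<inter> C = {0}"


section \<open>Pseudoconformal and strictly pseudoconformal manifolds\<close>

text \<open>
  The differential of \<open>id : (M, I) \<rightarrow> (M, J)\<close> is the identity on complexified tangent vectors, hence
  \<open>id\<^sub>* H10 \<subseteq> T10 M J\<close> reads as plain inclusion. Maximality is in dimension and uniqueness: every
  subbundle of positive rank with the same property is \<open>H10\<close> itself (the
  zero bundle has the property trivially and is excluded).
\<close>

definition psc_structure ::
    "'a::euclidean_space set \<Rightarrow> 'a chart set \<Rightarrow> 'a chart set \<Rightarrow> ('a \<Rightarrow> ('a \<times> 'a) set) \<Rightarrow> bool" where
  "psc_structure M I J H10 \<longleftrightarrow>
     smooth_submanifold 4 M \<and> complex_structure M I \<and> complex_structure M J \<and>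
     complex_subbundle 1 M H10 \<and>
     (\<forall>p\<in>M. H10 p \<subseteq> T10 M I p) \<and>
     (\<forall>p\<in>M. H10 p \<subseteq> T10 M J p) \<and>
     (\<forall>r\<ge>1. \<forall>K. complex_subbundle r M K \<and>
                (\<forall>p\<in>M. K p \<subseteq> T10 M I p) \<and> (\<forall>p\<in>M. K p \<subseteq> T10 M J p)
              \<longrightarrow> (\<forall>p\<in>M. K p = H10 p))"

definition psc_manifold :: "'a::euclidean_space set \<Rightarrow> 'a chart set \<Rightarrow> 'a chart set \<Rightarrow> bool" where
  "psc_manifold M I J \<longleftrightarrow> (\<exists>H10. psc_structure M I J H10)"

definition spsc_structure ::
    "'a::euclidean_space set \<Rightarrow> 'a chart set \<Rightarrow> 'a chart set \<Rightarrow>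
       ('a \<Rightarrow> ('a \<times> 'a) set) \<Rightarrow> ('a \<Rightarrow> ('a \<times> 'a) set) \<Rightarrow> bool" where
  "spsc_structure M I J H10 V10 \<longleftrightarrow>
     psc_structure M I J H10 \<and>
     complex_subbundle 1 M V10 \<and>
     (\<forall>p\<in>M. V10 p \<subseteq> T10 M I p) \<and>
     (\<forall>p\<in>M. is_direct_sum (T10 M I p) (H10 p) (V10 p)) \<and>
     (\<forall>p\<in>M. V10 p \<subseteq> T01 M J p)"

definition spsc_manifold :: "'a::euclidean_space set \<Rightarrow> 'a chart set \<Rightarrow> 'a chart set \<Rightarrow> bool" where
  "spsc_manifold M I J \<longleftrightarrow> (\<exists>H10 V10. spsc_structure M I J H10 V10)"

text \<open>The real bundle \<open>{X. X - \<i> I X \<in> B}\<close> underlying a subbundle \<open>B\<close> of the holomorphic tangent bundle.\<close>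

definition underlying_real :: "('a \<Rightarrow> ('a \<times> 'a) set) \<Rightarrow> 'a \<Rightarrow> 'a set" where
  "underlying_real B p = fst ` B p"


section \<open>CR submanifolds of complex Euclidean space\<close>

definition CR_bundle :: "(complex^'n) set \<Rightarrow> complex^'n \<Rightarrow> (complex^'n) set" where
  "CR_bundle M p = tangent_space M p \<inter> (\<lambda>X. \<i> *s X) ` tangent_space M p"

definition CR_submanifold :: "(complex^'n) set \<Rightarrow> bool" where
  "CR_submanifold M \<longleftrightarrow> (\<exists>d. smooth_submanifold d M) \<and> (\<exists>r. real_subbundle r M (CR_bundle M))"

definition antiholomorphic_CR_submanifold ::
    "(complex^'n) set \<Rightarrow> (complex^'n \<Rightarrow> (complex^'n) set) \<Rightarrow> (complex^'n \<Rightarrow> (complex^'n) set) \<Rightarrow> bool" where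
  "antiholomorphic_CR_submanifold M H V \<longleftrightarrow>
     CR_submanifold M \<and> (\<forall>p\<in>M. H p = CR_bundle M p) \<and>
     (\<exists>r. real_subbundle r M V) \<and>
     (\<forall>p\<in>M. is_direct_sum (tangent_space M p) (H p) (V p) \<and>
             (\<lambda>X. \<i> *s X) ` V p \<inter> tangent_space M p = {0})"


section \<open>The cross-ratio variety\<close>

text \<open>
  The condition \<open>X $ 1 \<noteq> 0\<close> is implicit in the first defining equation, where \<open>X $ 1\<close> is a denominator.
\<close>

definition cross_ratio_variety :: "(complex^3) set" (\<open>\<XX>\<close>) where
  "\<XX> = {X. X$1 \<noteq> 0 \<and>
          (cmod (X$3))\<^sup>2 = (cmod (X$2))\<^sup>2 / (cmod (X$1))\<^sup>2 \<and>
          2 * (cmod (X$1))\<^sup>2 * Re (X$3) =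
            (cmod (X$1))\<^sup>2 + (cmod (X$2))\<^sup>2 - 2 * Re (X$1) - 2 * Re (X$2) + 1}"

definition Xstar :: "(complex^3) set" where
  "Xstar = {X \<in> \<XX>. Im (X$3) \<noteq> 0}"

definition Xstar_plus :: "(complex^3) set" where
  "Xstar_plus = {X \<in> Xstar. Im (X$3) > 0}"

definition Xstar_minus :: "(complex^3) set" where
  "Xstar_minus = {X \<in> Xstar. Im (X$3) < 0}"

text \<open>
  On \<open>\<XX>\<close>, \<open>X $ 2 = 0\<close> holds iff \<open>X $ 3 = 0\<close>; such points violate the second equation below
  also with the convention \<open>1 / 0 = 0\<close>, so nonvanishing need not be required separately.
\<close>

definition X_CR :: "(complex^3) set" where
  "X_CR = {X \<in> \<XX>. X$1 + X$2 = 1 \<and> 1 / X$2 + 1 / X$3 = 1 \<and> X$3 + 1 / X$1 = 1}"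

definition Tinv :: "complex^3 \<Rightarrow> complex^3" where
  "Tinv X = vector [X$1, X$2, cnj (X$3)]"

definition X_CR_star :: "(complex^3) set" where
  "X_CR_star = Tinv ` X_CR"

definition singular_set :: "(complex^3) set" where
  "singular_set = (X_CR \<union> X_CR_star) \<inter> Xstar"

definition M_proj :: "complex^3 \<Rightarrow> complex^2" where
  "M_proj X = vector [X$1, X$2]"

definition I_atlas :: "(complex^3) chart set" where
  "I_atlas = {(Xstar_plus, M_proj), (Xstar_minus, M_proj)}"

text \<open>
  Points of the complex projective line are the lines through the origin of \<open>\<complex>\<^sup>2\<close>. The charts
  send \<open>[1 : w]\<close>, respectively \<open>[w : 1]\<close>, to \<open>w\<close>.
\<close>

definition proj_point :: "complex \<Rightarrow> complex \<Rightarrow> (complex^2) set" where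
  "proj_point a b = range (\<lambda>c. c *s vector [a, b])"

definition CP1_times_nonreal_atlas :: "((complex^2) set \<times> complex) chart set" where
  "CP1_times_nonreal_atlas =
     {({proj_point 1 w | w. True} \<times> (- \<real>),
        \<lambda>(L, z). vector [THE w. L = proj_point 1 w, z]),
      ({proj_point w 1 | w. True} \<times> (- \<real>),
        \<lambda>(L, z). vector [THE w. L = proj_point w 1, z])}"

definition N_map :: "complex^3 \<Rightarrow> (complex^2) set \<times> complex" where
  "N_map X =
     (let z1 = X$1 + X$2 / X$3; z4 = X$1 + X$2 - 1
      in (if z1 = 0 \<and> z4 = 0 then proj_point 0 1 else proj_point z1 z4, X$3))"

definition J_atlas :: "(complex^3) chart set" where
  "J_atlas = pullback_atlas N_map Xstar CP1_times_nonreal_atlas"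

definition H_bundle :: "complex^3 \<Rightarrow> (complex^3) set" where
  "H_bundle p = CR_bundle \<XX> p"

text \<open>The push-forward \<open>\<T>\<^sub>*(\<H>)\<close>; \<open>Tinv\<close> is its own inverse.\<close>

definition V_bundle :: "complex^3 \<Rightarrow> (complex^3) set" where
  "V_bundle p = frechet_derivative Tinv (at (Tinv p)) ` H_bundle (Tinv p)"

definition Xstar_reg :: "(complex^3) set" where
  "Xstar_reg = Xstar - singular_set"

definition I_reg :: "(complex^3) chart set" where
  "I_reg = restrict_atlas I_atlas Xstar_reg"

definition J_reg :: "(complex^3) chart set" where
  "J_reg = restrict_atlas J_atlas Xstar_reg"

end

theory Submission
  imports Defs
begin

text \<open>
  Write \<open>z1 = X1 + X2 / X3\<close>, \<open>z4 = X1 + X2 - 1\<close> and \<open>w = z4 / z1\<close>.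

  The regular part of \<open>\<XX>\<^sup>*\<close> is cut out by the single inequality \<open>z4 \<noteq> 0\<close> (\<open>Xstar_reg_iff\<close>):
  if \<open>X1 + X2 = 1\<close>, the defining equations give \<open>X3\<close> the real part and the modulus of \<open>1 - 1 / X1\<close>,
  so \<open>X3\<close> is that number, a point of \<open>X_CR\<close>, or its conjugate, a point of \<open>X_CR_star\<close>. The
  equations also show that \<open>z1 = 0\<close> forces \<open>z4 = 0\<close>. Thus \<open>w\<close> is finite and nonzero throughout the
  regular part, each of the two affine charts of the projective line covers all of it, and \<open>J\<close> is
  the structure of the single chart \<open>(w, X3)\<close>. Explicit inverses show that this chart and the charts
  \<open>(X1, X2)\<close> of \<open>I\<close> are diffeomorphisms onto open sets.

  Tangent vectors \<open>(v1, v2, v3)\<close> are the solutions of the two linearised equations, and \<open>v3\<close> is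
  determined by \<open>(v1, v2)\<close>; \<open>I\<close> multiplies \<open>v1\<close> and \<open>v2\<close> by \<open>\<i>\<close>, while \<open>J\<close> multiplies \<open>dw\<close> and \<open>v3\<close>
  by \<open>\<i>\<close>. The bundle \<open>\<H>\<close> is the complex kernel of the \<open>(1,0)\<close>-parts of the two differentials, a
  complex line spanned by their cross product \<open>Z\<close>. Since \<open>X1\<close>, \<open>X2\<close>, \<open>w\<close> and \<open>X3\<close> are
  holomorphic in the ambient space, \<open>I\<close> and \<open>J\<close> agree on \<open>\<H>\<close> with the ambient multiplication by \<open>\<i>\<close>.

  On \<open>\<V> = \<T>\<^sub>*(\<H>)\<close> the tangent vector \<open>(\<i> v1, \<i> v2, - \<i> v3)\<close> is again in \<open>\<V>\<close>, so it is \<open>I v\<close>. It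
  equals \<open>- J v\<close> exactly if \<open>dw\<close> sends it to \<open>- \<i> dw v\<close>, that is, if the part of \<open>dw\<close> depending on
  \<open>(v1, v2)\<close> vanishes on \<open>W = \<T>\<^sub>*(Z)\<close>. This is the polynomial identity
  \<open>cross_ratio_identity\<close>, a consequence of the two equations and the heart of the theorem.

  A vector in \<open>\<H> \<inter> \<V>\<close> has \<open>\<i> v3 = - \<i> v3\<close>, hence \<open>v3 = 0\<close>, hence \<open>v = 0\<close> because the third
  component of \<open>Z\<close> is a nonzero multiple of the conjugate of \<open>z4\<close>. So \<open>T = \<H> \<oplus> \<V>\<close>, and \<open>I = J\<close> exactly
  on \<open>\<H>\<close>, \<open>I = - J\<close> exactly on \<open>\<V>\<close>. In other words, \<open>T\<^sup>1\<^sup>0(I) \<inter> T\<^sup>1\<^sup>0(J)\<close> and \<open>T\<^sup>1\<^sup>0(I) \<inter> T\<^sup>0\<^sup>1(J)\<close> are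
  the complex line bundles over \<open>\<H>\<close> and \<open>\<V>\<close> (\<open>horizontal10_eq_Int\<close>, \<open>vertical10_eq_Int\<close>). A subbundle of positive
  rank inside a line bundle is the whole line bundle (\<open>subbundle_of_line\<close>), which yields
  maximality and the uniqueness of the strictly pseudoconformal structure.
\<close>

section \<open>Closure properties of smooth maps\<close>

lemma Ck_on_SucE:
  assumes "Ck_on (Suc k) S f"
  obtains f' where "\<forall>x\<in>S. (f has_derivative f' x) (at x)" "\<forall>v. Ck_on k S (\<lambda>x. f' x v)"
  using assms unfolding Ck_on.simps(2) by blast

lemma Ck_on_SucI:
  assumes "\<forall>x\<in>S. (f has_derivative f' x) (at x)" "\<forall>v. Ck_on k S (\<lambda>x. f' x v)"
  shows "Ck_on (Suc k) S f"
  using assms unfolding Ck_on.simps(2) by blast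

lemma Ck_on_cong:
  assumes "open S" "Ck_on k S f" "\<And>x. x \<in> S \<Longrightarrow> f x = g x"
  shows "Ck_on k S g"
proof (cases k)
  case 0
  then show ?thesis using assms by (metis Ck_on.simps(1) continuous_on_cong)
next
  case (Suc m)
  with assms(2) obtain f' where f': "\<forall>x\<in>S. (f has_derivative f' x) (at x)"
    "\<forall>v. Ck_on m S (\<lambda>x. f' x v)" by (auto elim: Ck_on_SucE simp del: Ck_on.simps)
  have "\<forall>x\<in>S. (g has_derivative f' x) (at x)"
    using f'(1) assms by (auto intro: has_derivative_transform_within_open)
  then show ?thesis using f'(2) Suc by auto
qed

text \<open>
  The derivative of a product, a reciprocal or a square root contains the function itself, so the
  inductions on the order of differentiability below need the function to be of the lower class as well.
\<close>
lemma Ck_on_Suc_imp: "Ck_on (Suc k) S f \<Longrightarrow> Ck_on k S f"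
proof (induction k arbitrary: f)
  case 0
  then show ?case
    by (auto intro!: continuous_at_imp_continuous_on) (metis has_derivative_continuous)
next
  case (Suc k)
  from Suc.prems obtain f' where f': "\<forall>x\<in>S. (f has_derivative f' x) (at x)"
     "\<forall>v. Ck_on (Suc k) S (\<lambda>x. f' x v)" by (rule Ck_on_SucE)
  then show ?case using Suc.IH by (intro Ck_on_SucI[of S f f']) blast+
qed

lemma Ck_on_const: "Ck_on k S (\<lambda>x. c)"
proof (induction k arbitrary: c)
  case (Suc k)
  then show ?case by (auto intro!: exI[of _ "\<lambda>_ _. 0"])
qed auto

lemma Ck_on_bounded_linear:
  assumes "bounded_linear L"
  shows "Ck_on k S f \<Longrightarrow> Ck_on k S (\<lambda>x. L (f x))"
proof (induction k arbitrary: f)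
  case 0
  then show ?case using bounded_linear.continuous_on[OF assms] by auto
next
  case (Suc k)
  from Suc.prems obtain f' where f': "\<forall>x\<in>S. (f has_derivative f' x) (at x)"
    "\<forall>v. Ck_on k S (\<lambda>x. f' x v)"
    by (rule Ck_on_SucE)
  then have "\<forall>x\<in>S. ((\<lambda>x. L (f x)) has_derivative (\<lambda>v. L (f' x v))) (at x)"
    using bounded_linear.has_derivative[OF assms] by blast
  then show ?case using f'(2) Suc.IH by (intro Ck_on_SucI[where f' = "\<lambda>x v. L (f' x v)"]) blast+
qed

lemma Ck_on_ident: "Ck_on k S (\<lambda>x. x)"
proof (cases k)
  case (Suc m)
  then show ?thesis by (auto intro!: exI[of _ "\<lambda>x v. v"] Ck_on_const has_derivative_ident)
qed auto

lemma Ck_on_add: "Ck_on k S f \<Longrightarrow> Ck_on k S g \<Longrightarrow> Ck_on k S (\<lambda>x. f x + g x)"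
proof (induction k arbitrary: f g)
  case 0
  then show ?case by (auto intro: continuous_intros)
next
  case (Suc k)
  from Suc.prems(1) obtain f' where f': "\<forall>x\<in>S. (f has_derivative f' x) (at x)"
    "\<forall>v. Ck_on k S (\<lambda>x. f' x v)" by (rule Ck_on_SucE)
  from Suc.prems(2) obtain g' where g': "\<forall>x\<in>S. (g has_derivative g' x) (at x)"
    "\<forall>v. Ck_on k S (\<lambda>x. g' x v)" by (rule Ck_on_SucE)
  have "\<forall>x\<in>S. ((\<lambda>x. f x + g x) has_derivative (\<lambda>v. f' x v + g' x v)) (at x)"
    using f'(1) g'(1) by (auto intro: has_derivative_add)
  then show ?case using f'(2) g'(2) Suc.IH by (intro Ck_on_SucI[where f' = "\<lambda>x v. f' x v + g' x v"]) blast+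
qed

lemma Ck_on_bilinear:
  assumes B: "bounded_bilinear B"
  shows "Ck_on k S f \<Longrightarrow> Ck_on k S g \<Longrightarrow> Ck_on k S (\<lambda>x. B (f x) (g x))"
proof (induction k arbitrary: f g)
  case 0
  then show ?case by (auto intro: bounded_bilinear.continuous_on[OF B])
next
  case (Suc k)
  from Suc.prems(1) obtain f' where f': "\<forall>x\<in>S. (f has_derivative f' x) (at x)"
    "\<forall>v. Ck_on k S (\<lambda>x. f' x v)" by (rule Ck_on_SucE)
  from Suc.prems(2) obtain g' where g': "\<forall>x\<in>S. (g has_derivative g' x) (at x)"
    "\<forall>v. Ck_on k S (\<lambda>x. g' x v)" by (rule Ck_on_SucE)
  have d: "\<forall>x\<in>S. ((\<lambda>x. B (f x) (g x)) has_derivative (\<lambda>v. B (f x) (g' x v) + B (f' x v) (g x))) (at x)"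
    using f'(1) g'(1) by (auto intro: bounded_bilinear.FDERIV[OF B])
  have "Ck_on k S f" "Ck_on k S g" by (rule Suc.prems[THEN Ck_on_Suc_imp])+
  then have "\<forall>v. Ck_on k S (\<lambda>x. B (f x) (g' x v) + B (f' x v) (g x))"
    using f'(2) g'(2) Suc.IH by (intro allI Ck_on_add) auto
  then show ?case using d by (intro Ck_on_SucI)
qed

lemma Ck_on_inverse:
  fixes f :: "'a::euclidean_space \<Rightarrow> 'b::real_normed_field"
  assumes "\<And>x. x \<in> S \<Longrightarrow> f x \<noteq> 0"
  shows "Ck_on k S f \<Longrightarrow> Ck_on k S (\<lambda>x. inverse (f x))"
proof (induction k)
  case 0
  then show ?case using assms by (auto intro!: continuous_intros)
next
  case (Suc k)
  from Suc.prems obtain f' where f': "\<forall>x\<in>S. (f has_derivative f' x) (at x)"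
    "\<forall>v. Ck_on k S (\<lambda>x. f' x v)"
    by (rule Ck_on_SucE)
  let ?d = "\<lambda>x v. (- 1) * (inverse (f x) * f' x v * inverse (f x))"
  have d: "\<forall>x\<in>S. ((\<lambda>x. inverse (f x)) has_derivative ?d x) (at x)"
  proof
    fix x assume "x \<in> S"
    then show "((\<lambda>x. inverse (f x)) has_derivative ?d x) (at x)"
      using f'(1) assms by simp
  qed
  have i: "Ck_on k S (\<lambda>x. inverse (f x))" by (rule Suc.IH[OF Ck_on_Suc_imp[OF Suc.prems]])
  have "\<forall>v. Ck_on k S (\<lambda>x. ?d x v)"
    using f'(2) by (intro allI Ck_on_bilinear[OF bounded_bilinear_mult] Ck_on_const i) auto
  then show ?case using d by (intro Ck_on_SucI[where f' = ?d])
qed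

lemma Ck_on_sqrt:
  fixes f :: "'a::euclidean_space \<Rightarrow> real"
  assumes pos: "\<And>x. x \<in> S \<Longrightarrow> f x > 0"
  shows "Ck_on k S f \<Longrightarrow> Ck_on k S (\<lambda>x. sqrt (f x))"
proof (induction k)
  case 0
  then show ?case by (auto intro!: continuous_intros)
next
  case (Suc k)
  from Suc.prems obtain f' where f': "\<forall>x\<in>S. (f has_derivative f' x) (at x)"
    "\<forall>v. Ck_on k S (\<lambda>x. f' x v)"
    by (rule Ck_on_SucE)
  let ?d = "\<lambda>x v. f' x v * (inverse (sqrt (f x)) / 2)"
  have d: "\<forall>x\<in>S. ((\<lambda>x. sqrt (f x)) has_derivative ?d x) (at x)"
  proof
    fix x assume "x \<in> S"
    show "((\<lambda>x. sqrt (f x)) has_derivative ?d x) (at x)"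
      by (rule has_derivative_real_sqrt[where g = f and g' = "f' x" and x = x and s = UNIV])
        (use \<open>x \<in> S\<close> f'(1) pos in blast)+
  qed
  have i: "Ck_on k S (\<lambda>x. sqrt (f x))" by (rule Suc.IH[OF Ck_on_Suc_imp[OF Suc.prems]])
  have nz: "\<And>x. x \<in> S \<Longrightarrow> sqrt (f x) \<noteq> 0" using pos by fastforce
  have "\<forall>v. Ck_on k S (\<lambda>x. ?d x v)"
    using f'(2) nz i
    by (intro allI Ck_on_bilinear[OF bounded_bilinear_mult] Ck_on_bounded_linear[OF bounded_linear_divide]
        Ck_on_inverse) blast+
  then show ?case using d by (intro Ck_on_SucI[where f' = ?d])
qed

text \<open>
  For an affine inner map the derivative of the composition is \<open>g'\<close> in a fixed direction \<open>L v\<close>,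
  composed with the same affine map; the induction therefore needs no further chain rule.
\<close>
lemma Ck_on_comp_affine:
  fixes g :: "'b::euclidean_space \<Rightarrow> 'c::real_normed_vector"
    and L :: "'a::euclidean_space \<Rightarrow> 'b"
  assumes L: "bounded_linear L" and im: "\<And>x. x \<in> S \<Longrightarrow> a + L x \<in> T"
  shows "Ck_on k T g \<Longrightarrow> Ck_on k S (\<lambda>x. g (a + L x))"
proof (induction k arbitrary: g)
  case 0
  have "continuous_on S (\<lambda>x. a + L x)"
    by (intro continuous_intros linear_continuous_on L)
  then show ?case using 0 im by (auto intro: continuous_on_compose2)
next
  case (Suc k)
  from Suc.prems obtain g' where g': "\<forall>x\<in>T. (g has_derivative g' x) (at x)" "\<forall>v. Ck_on k T (\<lambda>x. g' x v)"
    by (rule Ck_on_SucE)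
  have "((\<lambda>x. g (a + L x)) has_derivative (\<lambda>v. g' (a + L x) (L v))) (at x)" if "x \<in> S" for x
  proof -
    have "((\<lambda>x. a + L x) has_derivative L) (at x)"
      using has_derivative_add[OF has_derivative_const bounded_linear.has_derivative[OF L has_derivative_ident]]
      by simp
    moreover have "(g has_derivative g' (a + L x)) (at (a + L x))" using g'(1) im that by blast
    ultimately show ?thesis by (rule has_derivative_compose)
  qed
  moreover have "\<forall>v. Ck_on k S (\<lambda>x. g' (a + L x) (L v))" using g'(2) Suc.IH by blast
  ultimately show ?case by (intro Ck_on_SucI[where f' = "\<lambda>x v. g' (a + L x) (L v)"]) blast+
qed

lemma smooth_on_open: "smooth_on S f \<Longrightarrow> open S"
  by (simp add: smooth_on_def)

lemma smooth_on_imp_Ck_on: "smooth_on S f \<Longrightarrow> Ck_on k S f"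
  unfolding smooth_on_def by (elim conjE allE)

lemma smooth_onI: "open S \<Longrightarrow> (\<And>k. Ck_on k S f) \<Longrightarrow> smooth_on S f"
  unfolding smooth_on_def by (intro conjI allI)

lemma smooth_on_has_derivative:
  assumes "smooth_on S f" "x \<in> S"
  obtains D where "(f has_derivative D) (at x)"
proof -
  have "Ck_on (Suc 0) S f" by (rule smooth_on_imp_Ck_on[OF assms(1)])
  then obtain f' where "\<forall>x\<in>S. (f has_derivative f' x) (at x)" by (rule Ck_on_SucE)
  then show ?thesis using that[of "f' x"] assms(2) by simp
qed

lemma smooth_on_continuous_on: "smooth_on S f \<Longrightarrow> continuous_on S f"
  using smooth_on_imp_Ck_on[of S f 0] by simp

lemma smooth_on_cong:
  "smooth_on S f \<Longrightarrow> (\<And>x. x \<in> S \<Longrightarrow> f x = g x) \<Longrightarrow> smooth_on S g"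
  by (rule smooth_onI[OF smooth_on_open Ck_on_cong[OF smooth_on_open smooth_on_imp_Ck_on]])

lemma smooth_on_const: "open S \<Longrightarrow> smooth_on S (\<lambda>x. c)"
  by (rule smooth_onI[OF _ Ck_on_const])

lemma smooth_on_ident: "open S \<Longrightarrow> smooth_on S (\<lambda>x. x)"
  by (rule smooth_onI[OF _ Ck_on_ident])

lemma smooth_on_bounded_linear:
  "bounded_linear L \<Longrightarrow> smooth_on S f \<Longrightarrow> smooth_on S (\<lambda>x. L (f x))"
  by (rule smooth_onI[OF smooth_on_open Ck_on_bounded_linear[OF _ smooth_on_imp_Ck_on]])

lemma smooth_on_add: "smooth_on S f \<Longrightarrow> smooth_on S g \<Longrightarrow> smooth_on S (\<lambda>x. f x + g x)"
  by (rule smooth_onI[OF smooth_on_open Ck_on_add[OF smooth_on_imp_Ck_on smooth_on_imp_Ck_on]])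

lemma smooth_on_mult:
  fixes f g :: "_ \<Rightarrow> 'a::real_normed_algebra"
  shows "smooth_on S f \<Longrightarrow> smooth_on S g \<Longrightarrow> smooth_on S (\<lambda>x. f x * g x)"
  by (rule smooth_onI[OF smooth_on_open Ck_on_bilinear[OF bounded_bilinear_mult smooth_on_imp_Ck_on smooth_on_imp_Ck_on]])

lemma smooth_on_minus: "smooth_on S f \<Longrightarrow> smooth_on S (\<lambda>x. - f x)"
  by (rule smooth_on_bounded_linear[OF bounded_linear_minus[OF bounded_linear_ident]])

lemma smooth_on_diff: "smooth_on S f \<Longrightarrow> smooth_on S g \<Longrightarrow> smooth_on S (\<lambda>x. f x - g x)"
  using smooth_on_add[OF _ smooth_on_minus, of S f g] by simp

lemma smooth_on_inverse:
  fixes f :: "_ \<Rightarrow> 'a::real_normed_field"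
  shows "smooth_on S f \<Longrightarrow> (\<And>x. x \<in> S \<Longrightarrow> f x \<noteq> 0) \<Longrightarrow> smooth_on S (\<lambda>x. inverse (f x))"
  by (rule smooth_onI[OF smooth_on_open Ck_on_inverse[OF _ smooth_on_imp_Ck_on]])

lemma smooth_on_divide:
  fixes f g :: "_ \<Rightarrow> 'a::real_normed_field"
  shows "smooth_on S f \<Longrightarrow> smooth_on S g \<Longrightarrow> (\<And>x. x \<in> S \<Longrightarrow> g x \<noteq> 0) \<Longrightarrow>
    smooth_on S (\<lambda>x. f x / g x)"
  unfolding divide_inverse by (intro smooth_on_mult smooth_on_inverse)

lemma smooth_on_power2:
  fixes f :: "_ \<Rightarrow> 'a::{real_normed_algebra, monoid_mult}"
  assumes "smooth_on S f" shows "smooth_on S (\<lambda>x. (f x)\<^sup>2)"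
  using smooth_on_mult[OF assms assms] by (simp add: power2_eq_square)

lemma smooth_on_cmod_power2:
  assumes "smooth_on S f" shows "smooth_on S (\<lambda>x. (cmod (f x))\<^sup>2)"
  unfolding cmod_power2
  by (intro smooth_on_add smooth_on_power2 smooth_on_bounded_linear[OF bounded_linear_Re]
      smooth_on_bounded_linear[OF bounded_linear_Im] assms)

lemma smooth_on_sqrt:
  fixes f :: "_ \<Rightarrow> real"
  shows "smooth_on S f \<Longrightarrow> (\<And>x. x \<in> S \<Longrightarrow> f x > 0) \<Longrightarrow> smooth_on S (\<lambda>x. sqrt (f x))"
  by (rule smooth_onI[OF smooth_on_open Ck_on_sqrt[OF _ smooth_on_imp_Ck_on]])

lemma smooth_on_comp_affine:
  assumes "bounded_linear L" "\<And>x. x \<in> S \<Longrightarrow> a + L x \<in> T" "open S" "smooth_on T g"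
  shows "smooth_on S (\<lambda>x. g (a + L x))"
  by (rule smooth_onI[OF assms(3) Ck_on_comp_affine[OF assms(1,2) smooth_on_imp_Ck_on[OF assms(4)]]])

text \<open>
  Writing \<open>vector\<close> as a sum of axis vectors reduces vector-valued maps to sums of bounded linear
  images of their components.
\<close>
lemma bounded_linear_axis: "bounded_linear (\<lambda>x::'a::euclidean_space. axis i x :: 'a^'n)"
  by (auto intro!: linear_conv_bounded_linear[THEN iffD1] linearI simp: vec_eq_iff axis_def)

lemma vector_2_axis: "vector [a, b] = (axis 1 a + axis 2 b :: 'a::comm_monoid_add^2)"
  by (simp add: vec_eq_iff forall_2 axis_def)

lemma vector_3_axis: "vector [a, b, c] = (axis 1 a + axis 2 b + axis 3 c :: 'a::comm_monoid_add^3)"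
  by (simp add: vec_eq_iff forall_3 axis_def)

lemma smooth_on_vector_2:
  fixes f g :: "_ \<Rightarrow> 'a::euclidean_space"
  shows "smooth_on S f \<Longrightarrow> smooth_on S g \<Longrightarrow> smooth_on S (\<lambda>x. vector [f x, g x] :: 'a^2)"
  unfolding vector_2_axis by (intro smooth_on_add smooth_on_bounded_linear[OF bounded_linear_axis])

lemma smooth_on_vector_3:
  fixes f g h :: "_ \<Rightarrow> 'a::euclidean_space"
  shows "smooth_on S f \<Longrightarrow> smooth_on S g \<Longrightarrow> smooth_on S h \<Longrightarrow>
    smooth_on S (\<lambda>x. vector [f x, g x, h x] :: 'a^3)"
  unfolding vector_3_axis by (intro smooth_on_add smooth_on_bounded_linear[OF bounded_linear_axis])

lemma smooth_on_Pair:
  assumes "smooth_on S f" "smooth_on S g"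
  shows "smooth_on S (\<lambda>x. (f x, g x))"
proof -
  have "smooth_on S (\<lambda>x. (f x, 0))"
    by (rule smooth_on_bounded_linear[where L = "\<lambda>a. (a, 0)", OF _ assms(1)])
      (intro bounded_linear_Pair bounded_linear_ident bounded_linear_zero)
  moreover have "smooth_on S (\<lambda>x. (0, g x))"
    by (rule smooth_on_bounded_linear[where L = "\<lambda>b. (0, b)", OF _ assms(2)])
      (intro bounded_linear_Pair bounded_linear_ident bounded_linear_zero)
  ultimately have "smooth_on S (\<lambda>x. (f x, 0) + (0, g x))"
    by (rule smooth_on_add)
  then show ?thesis by simp
qed

lemmas smooth_intros = smooth_on_const smooth_on_ident smooth_on_add smooth_on_diff smooth_on_minus
  smooth_on_mult smooth_on_power2 smooth_on_cmod_power2 smooth_on_vector_2 smooth_on_vector_3 smooth_on_Pair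
  smooth_on_bounded_linear[OF bounded_linear_Re] smooth_on_bounded_linear[OF bounded_linear_Im]
  smooth_on_bounded_linear[OF bounded_linear_cnj] smooth_on_bounded_linear[OF bounded_linear_of_real]
  smooth_on_bounded_linear[OF bounded_linear_vec_nth]

lemma has_derivative_vector_2:
  fixes f g :: "_ \<Rightarrow> 'a::euclidean_space"
  assumes "(f has_derivative f') F" "(g has_derivative g') F"
  shows "((\<lambda>x. vector [f x, g x] :: 'a^2) has_derivative (\<lambda>v. vector [f' v, g' v])) F"
  unfolding vector_2_axis
  by (intro has_derivative_add bounded_linear.has_derivative[OF bounded_linear_axis] assms)

section \<open>Tangent vectors in charts\<close>

lemma tangent_curve_in_chart:
  assumes U: "openin (top_of_set M) U" "p \<in> U" and v: "v \<in> tangent_space M p"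
  obtains e \<gamma> where "(e::real) > 0" "\<gamma> ` {-e<..<e} \<subseteq> U" "\<gamma> 0 = p" "(\<gamma> has_vector_derivative v) (at 0)"
proof -
  obtain e \<gamma> where \<gamma>: "e > 0" "\<gamma> ` {-e<..<e} \<subseteq> M" "\<gamma> 0 = p" "(\<gamma> has_vector_derivative v) (at (0::real))"
    using v unfolding tangent_space_def by blast
  obtain W where W: "open W" "U = M \<inter> W" using U(1) by (auto simp: openin_open)
  have "continuous (at 0) \<gamma>" using \<gamma>(4) by (rule has_vector_derivative_continuous)
  then have "(\<gamma> \<longlongrightarrow> p) (at 0)" using \<gamma>(3) by (simp add: continuous_at)
  then have "\<forall>\<^sub>F t in at 0. \<gamma> t \<in> W" using W U(2) by (auto dest: topological_tendstoD)
  then obtain d where d: "d > 0" "\<And>t. t \<noteq> 0 \<Longrightarrow> dist t 0 < d \<Longrightarrow> \<gamma> t \<in> W"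
    unfolding eventually_at by auto
  have "\<gamma> t \<in> U" if "t \<in> {-(min d e)<..<min d e}" for t
  proof (cases "t = 0")
    case True then show ?thesis using \<gamma>(3) U(2) by simp
  next
    case False
    have "\<gamma> t \<in> M" using \<gamma>(2) that by auto
    then show ?thesis using d(2)[OF False] that W(2) by (auto simp: dist_real_def)
  qed
  then show thesis using \<gamma> d(1) by (intro that[of "min d e" \<gamma>]) auto
qed

text \<open>
  The chain rule along a curve in \<open>U\<close>: although the derivative of \<open>\<phi>\<close> within \<open>U\<close> need not be
  unique, its value on the velocity vector is.
\<close>
lemma has_vector_derivative_chart_curve:
  assumes \<phi>: "(\<phi> has_derivative D) (at p within U)"
    and \<gamma>: "e > 0" "\<gamma> ` {-e<..<e} \<subseteq> U" "\<gamma> 0 = p" "(\<gamma> has_vector_derivative v) (at (0::real))"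
  shows "((\<lambda>t. \<phi> (\<gamma> t)) has_vector_derivative D v) (at 0)"
proof -
  let ?S = "{-e<..<e}"
  have 1: "(\<gamma> has_derivative (\<lambda>h. h *\<^sub>R v)) (at 0 within ?S)"
    using \<gamma>(4) by (simp add: has_vector_derivative_def has_derivative_at_withinI)
  have 2: "(\<phi> has_derivative D) (at (\<gamma> 0) within \<gamma> ` ?S)"
    using has_derivative_subset[OF \<phi> \<gamma>(2)] \<gamma>(3) by simp
  have "((\<lambda>t. \<phi> (\<gamma> t)) has_derivative (\<lambda>h. D (h *\<^sub>R v))) (at 0 within ?S)"
    by (rule has_derivative_in_compose[OF 1 2])
  moreover have "(\<lambda>h. D (h *\<^sub>R v)) = (\<lambda>h. h *\<^sub>R D v)"
    using has_derivative_linear[OF \<phi>] by (simp add: linear_scale)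
  moreover have "at 0 within ?S = at (0::real)"
    using \<gamma>(1) by (intro at_within_open) auto
  ultimately show ?thesis by (simp add: has_vector_derivative_def)
qed

lemma complex_structureD:
  assumes "complex_structure M A" "(U, \<phi>) \<in> A"
  shows "openin (top_of_set M) U" "inj_on \<phi> U" "open (\<phi> ` U)" "smooth_map_on U \<phi>"
    "smooth_on (\<phi> ` U) (inv_into U \<phi>)"
    "(U', \<phi>') \<in> A \<Longrightarrow> holomorphic_map_on (\<phi> ` (U \<inter> U')) (\<phi>' \<circ> inv_into U \<phi>)"
  using assms unfolding complex_structure_def by blast+

text \<open>
  A curve in \<open>U\<close> is recovered from its image in the chart by the smooth inverse of the chart;
  differentiating recovers the tangent vector.
\<close>
lemma chart_derivative_inj:
  assumes cs: "complex_structure M A" "(U, \<phi>) \<in> A" and p: "p \<in> U"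
    and D: "(\<phi> has_derivative D) (at p within U)"
    and v: "v \<in> tangent_space M p" "v' \<in> tangent_space M p" "D v = D v'"
  shows "v = v'"
proof -
  obtain E where E: "(inv_into U \<phi> has_derivative E) (at (\<phi> p))"
    using smooth_on_has_derivative[OF complex_structureD(5)[OF cs]] p by blast
  have "w = E (D w)" if w: "w \<in> tangent_space M p" for w
  proof -
    obtain e \<gamma> where \<gamma>: "e > 0" "\<gamma> ` {-e<..<e} \<subseteq> U" "\<gamma> 0 = p" "(\<gamma> has_vector_derivative w) (at (0::real))"
      using tangent_curve_in_chart[OF complex_structureD(1)[OF cs] p w] by blast
    have "((\<lambda>t. inv_into U \<phi> (\<phi> (\<gamma> t))) has_vector_derivative E (D w)) (at 0)"
      by (rule has_vector_derivative_chart_curve[where U = UNIV and e = e and p = "\<phi> p" and \<gamma> = "\<lambda>t. \<phi> (\<gamma> t)"])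
        (use E \<gamma> has_vector_derivative_chart_curve[OF D \<gamma>] in auto)
    then have "(\<gamma> has_vector_derivative E (D w)) (at 0)"
      by (rule has_vector_derivative_transform_within_open[where S = "{-e<..<e}"])
        (use \<gamma> complex_structureD(2)[OF cs] in \<open>auto simp: image_subset_iff\<close>)
    then show ?thesis using \<gamma>(4) vector_derivative_unique_at by blast
  qed
  then show ?thesis using v by metis
qed

text \<open>
  On tangent vectors the derivatives of two charts differ by the derivative of the transition map,
  which is complex linear.
\<close>
lemma chart_derivative_transition:
  assumes cs: "complex_structure M A" "(U, \<phi>) \<in> A" "(U', \<phi>') \<in> A" and p: "p \<in> U" "p \<in> U'"
    and D: "(\<phi> has_derivative D) (at p within U)" and D': "(\<phi>' has_derivative D') (at p within U')"
  obtains E where "\<And>c w. E (c *s w) = c *s E w" "\<And>v. v \<in> tangent_space M p \<Longrightarrow> D' v = E (D v)"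
proof -
  have "\<phi> p \<in> \<phi> ` (U \<inter> U')" using p by blast
  then obtain E where E: "((\<phi>' \<circ> inv_into U \<phi>) has_derivative E) (at (\<phi> p))" "\<And>c w. E (c *s w) = c *s E w"
    using complex_structureD(6)[OF cs] unfolding holomorphic_map_on_def by metis
  have "D' w = E (D w)" if w: "w \<in> tangent_space M p" for w
  proof -
    have "openin (top_of_set M) (U \<inter> U')" "p \<in> U \<inter> U'"
      using complex_structureD(1)[OF cs(1)] cs p by blast+
    then obtain e \<gamma> where \<gamma>: "e > 0" "\<gamma> ` {-e<..<e} \<subseteq> U \<inter> U'" "\<gamma> 0 = p"
      "(\<gamma> has_vector_derivative w) (at (0::real))"
      using tangent_curve_in_chart[OF _ _ w] by blast
    have U: "\<gamma> ` {-e<..<e} \<subseteq> U" "\<gamma> ` {-e<..<e} \<subseteq> U'" using \<gamma>(2) by blast+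
    have "((\<lambda>t. (\<phi>' \<circ> inv_into U \<phi>) (\<phi> (\<gamma> t))) has_vector_derivative E (D w)) (at 0)"
      by (rule has_vector_derivative_chart_curve[where \<phi> = "\<phi>' \<circ> inv_into U \<phi>" and D = E and U = UNIV
            and e = e and p = "\<phi> p" and \<gamma> = "\<lambda>t. \<phi> (\<gamma> t)"])
        (use E \<gamma> has_vector_derivative_chart_curve[OF D \<gamma>(1) U(1) \<gamma>(3,4)] in auto)
    then have "((\<lambda>t. \<phi>' (\<gamma> t)) has_vector_derivative E (D w)) (at 0)"
      by (rule has_vector_derivative_transform_within_open[where S = "{-e<..<e}"])
        (use \<gamma>(1) U(1) complex_structureD(2)[OF cs(1,2)] in \<open>auto simp: image_subset_iff\<close>)
    then show ?thesis
      using has_vector_derivative_chart_curve[OF D' \<gamma>(1) U(2) \<gamma>(3,4)] vector_derivative_unique_at by blast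
  qed
  then show thesis using E(2) that by blast
qed

text \<open>
  Consequently the complex structure on the tangent space can be computed in any one chart with any
  one derivative of it.
\<close>
lemma tangent_cs_eqI:
  assumes cs: "complex_structure M A" "(U, \<phi>) \<in> A" and p: "p \<in> U"
    and D: "(\<phi> has_derivative D) (at p within U)"
    and X: "X \<in> tangent_space M p" and Y: "Y \<in> tangent_space M p" "D Y = \<i> *s D X"
  shows "tangent_cs M A p X = Y"
  unfolding tangent_cs_def
proof (rule the_equality)
  show "Y \<in> tangent_space M p \<and>
    (\<exists>(U, \<phi>)\<in>A. p \<in> U \<and> (\<exists>D. (\<phi> has_derivative D) (at p within U) \<and> D Y = \<i> *s D X))"
    using assms by blast
next
  fix Y' assume "Y' \<in> tangent_space M p \<and>
    (\<exists>(U, \<phi>)\<in>A. p \<in> U \<and> (\<exists>D. (\<phi> has_derivative D) (at p within U) \<and> D Y' = \<i> *s D X))"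
  then obtain U' \<phi>' D' where Y': "Y' \<in> tangent_space M p" "(U', \<phi>') \<in> A" "p \<in> U'"
    "(\<phi>' has_derivative D') (at p within U')" "D' Y' = \<i> *s D' X" by blast
  obtain E where E: "\<And>c w. E (c *s w) = c *s E w" "\<And>v. v \<in> tangent_space M p \<Longrightarrow> D v = E (D' v)"
    using chart_derivative_transition[OF cs(1) Y'(2) cs(2) Y'(3) p Y'(4) D] by blast
  have "D Y' = D Y" using E Y' X Y by metis
  then show "Y' = Y" by (rule chart_derivative_inj[OF cs p D Y'(1) Y(1)])
qed

section \<open>The regular part and its parametrisations\<close>

lemma vec3_eqI: "(x::'a^3)$1 = y$1 \<Longrightarrow> x$2 = y$2 \<Longrightarrow> x$3 = y$3 \<Longrightarrow> x = y"
  by (simp add: vec_eq_iff forall_3)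

lemma vec2_eqI: "(x::'a^2)$1 = y$1 \<Longrightarrow> x$2 = y$2 \<Longrightarrow> x = y"
  by (simp add: vec_eq_iff forall_2)

lemma cmod_plus_power2: "(cmod (a + b))\<^sup>2 = (cmod a)\<^sup>2 + (cmod b)\<^sup>2 + 2 * Re (a * cnj b)"
  unfolding cmod_power2 by (simp add: power2_eq_square algebra_simps)

lemma cmod_minus_power2: "(cmod (a - b))\<^sup>2 = (cmod a)\<^sup>2 + (cmod b)\<^sup>2 - 2 * Re (a * cnj b)"
  unfolding cmod_power2 by (simp add: power2_eq_square algebra_simps)

definition modulus_eqn :: "complex^3 \<Rightarrow> real" where
  "modulus_eqn X = (cmod (X$1))\<^sup>2 * (cmod (X$3))\<^sup>2 - (cmod (X$2))\<^sup>2"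

definition real_part_eqn :: "complex^3 \<Rightarrow> real" where
  "real_part_eqn X = (cmod (X$1))\<^sup>2 + (cmod (X$2))\<^sup>2 - 2 * Re (X$1) - 2 * Re (X$2) + 1
     - 2 * (cmod (X$1))\<^sup>2 * Re (X$3)"

lemma cross_ratio_variety_iff:
  "X \<in> \<XX> \<longleftrightarrow> X$1 \<noteq> 0 \<and> modulus_eqn X = 0 \<and> real_part_eqn X = 0"
  by (auto simp: cross_ratio_variety_def modulus_eqn_def real_part_eqn_def divide_simps mult_ac)

lemma Tinv_nth [simp]: "Tinv X $ 1 = X $ 1" "Tinv X $ 2 = X $ 2" "Tinv X $ 3 = cnj (X $ 3)"
  by (simp_all add: Tinv_def)

lemma Tinv_Tinv [simp]: "Tinv (Tinv X) = X"
  by (rule vec3_eqI) simp_all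

lemma eq_or_cnj_if_Re_cmod_eq:
  assumes "Re a = Re b" "cmod a = cmod b"
  shows "a = b \<or> a = cnj b"
proof -
  have "(Im a)\<^sup>2 = (Im b)\<^sup>2"
    using assms cmod_power2[of a] cmod_power2[of b] by simp
  then show ?thesis using assms(1) by (auto simp: power2_eq_iff complex_eq_iff)
qed

text \<open>
  On \<open>X1 + X2 = 1\<close> the equations say \<open>Re X3 = Re b\<close> and \<open>\<bar>X3\<bar> = \<bar>b\<bar>\<close> for \<open>b = 1 - 1 / X1\<close>. The solution
  \<open>X3 = b\<close> satisfies the equations of \<open>X_CR\<close>, and \<open>X3 = cnj b\<close> is its image under \<open>Tinv\<close>.
\<close>
lemma Xstar_reg_iff:
  "X \<in> Xstar_reg \<longleftrightarrow> X$1 \<noteq> 0 \<and> modulus_eqn X = 0 \<and> real_part_eqn X = 0 \<and> Im (X$3) \<noteq> 0 \<and> X$1 + X$2 \<noteq> 1"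
proof -
  have sing: "X \<in> X_CR \<union> X_CR_star" if X: "X \<in> \<XX>" "Im (X$3) \<noteq> 0" and s: "X$1 + X$2 = 1" for X
  proof -
    define x b where "x = X$1" and "b = 1 - 1 / x"
    have x0: "x \<noteq> 0" and e: "modulus_eqn X = 0" "real_part_eqn X = 0"
      using X(1) by (auto simp: cross_ratio_variety_iff x_def)
    have x2: "X$2 = 1 - x" using s by (simp add: x_def eq_diff_eq add.commute)
    have "2 * (cmod x)\<^sup>2 * Re (X$3) = 2 * (cmod x)\<^sup>2 - 2 * Re x"
      using e(2) by (simp add: real_part_eqn_def x2 x_def[symmetric] cmod_minus_power2)
    moreover have "Re b = 1 - Re x / (cmod x)\<^sup>2"
      by (simp add: b_def Re_divide cmod_power2)
    then have "(cmod x)\<^sup>2 * Re b = (cmod x)\<^sup>2 - Re x" using x0 by (simp add: right_diff_distrib)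
    ultimately have "(cmod x)\<^sup>2 * Re (X$3) = (cmod x)\<^sup>2 * Re b" by linarith
    then have "Re (X$3) = Re b" using x0 by simp
    moreover have "cmod (X$3) = cmod b"
    proof -
      have "(cmod x * cmod (X$3))\<^sup>2 = (cmod (1 - x))\<^sup>2"
        using e(1) by (simp add: modulus_eqn_def x2 x_def[symmetric] power_mult_distrib)
      then have "cmod x * cmod (X$3) = cmod (1 - x)"
        by (subst (asm) power2_eq_iff_nonneg) auto
      moreover have "cmod x * cmod b = cmod (1 - x)"
        using x0 by (simp add: b_def norm_mult[symmetric] right_diff_distrib norm_minus_commute)
      ultimately show ?thesis using x0 by (metis mult_cancel_left norm_eq_zero)
    qed
    ultimately have b: "X$3 = b \<or> X$3 = cnj b" by (rule eq_or_cnj_if_Re_cmod_eq)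
    have CR: "Y \<in> X_CR" if Y: "Y \<in> \<XX>" "Y$1 = x" "Y$2 = 1 - x" "Y$3 = b" "Im (Y$3) \<noteq> 0" for Y
    proof -
      have "x \<noteq> 1" using Y by (auto simp: b_def)
      then have "1 / (1 - x) + 1 / b = 1" using x0 by (simp add: b_def divide_simps) (simp add: algebra_simps)
      then show ?thesis using Y by (simp add: X_CR_def b_def)
    qed
    have "Tinv X \<in> \<XX>" using X(1) by (simp add: cross_ratio_variety_iff modulus_eqn_def real_part_eqn_def)
    then show ?thesis
      using b CR[of X] CR[of "Tinv X"] X x2 unfolding X_CR_star_def
      by (auto simp: x_def intro: image_eqI[of X Tinv "Tinv X"])
  qed
  have "X$1 + X$2 = 1" if "X \<in> X_CR \<union> X_CR_star" for X
    using that by (auto simp: X_CR_def X_CR_star_def)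
  then show ?thesis
    using sing[of X] unfolding Xstar_reg_def singular_set_def Xstar_def
    by (auto simp: cross_ratio_variety_iff)
qed

lemma Tinv_Xstar_reg [simp]: "Tinv X \<in> Xstar_reg \<longleftrightarrow> X \<in> Xstar_reg"
  by (simp add: Xstar_reg_iff modulus_eqn_def real_part_eqn_def)

lemma Xstar_reg_nonzero:
  assumes "X \<in> Xstar_reg"
  shows "X$1 \<noteq> 0" "X$2 \<noteq> 0" "X$3 \<noteq> 0"
  using assms by (auto simp: Xstar_reg_iff modulus_eqn_def)

text \<open>The affine coordinate \<open>w = z4 / z1\<close> of the projective line together with \<open>X3\<close>.\<close>
definition J_coord :: "complex^3 \<Rightarrow> complex^2" where
  "J_coord X = vector [(X$1 + X$2 - 1) / (X$1 + X$2 / X$3), X$3]"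

text \<open>
  The inverse of \<open>J_coord\<close>. The quotient \<open>u = X1 / z1\<close> determines the point, because
  \<open>X2 / X3 = z1 (1 - u)\<close>. The equation \<open>\<bar>X2 / X3\<bar> = \<bar>X1\<bar>\<close> says \<open>\<bar>1 - u\<bar> = \<bar>u\<bar>\<close>, so
  \<open>Re u = 1 / 2\<close>; the second equation becomes \<open>\<bar>w\<bar>\<^sup>2 = 2 Re (cnj z u)\<close> with \<open>z = X3\<close>, which gives \<open>Im u\<close>.
  Finally \<open>z4 = X1 + X2 - 1\<close> reads \<open>z1 (u + cnj u z - w) = 1\<close>, so \<open>J_denom\<close> is \<open>1 / z1\<close>.
\<close>
definition J_weight :: "complex^2 \<Rightarrow> complex" where
  "J_weight y = Complex (1 / 2) (((cmod (y$1))\<^sup>2 - Re (y$2)) / (2 * Im (y$2)))"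

definition J_denom :: "complex^2 \<Rightarrow> complex" where
  "J_denom y = J_weight y + cnj (J_weight y) * y$2 - y$1"

definition J_param :: "complex^2 \<Rightarrow> complex^3" where
  "J_param y = vector [J_weight y / J_denom y, cnj (J_weight y) * y$2 / J_denom y, y$2]"

definition J_region :: "(complex^2) set" where
  "J_region = {y. y$1 \<noteq> 0 \<and> Im (y$2) \<noteq> 0}"

lemma real_part_eqn_cmod_z4:
  assumes "real_part_eqn X = 0"
  shows "(cmod (X$1 + X$2 - 1))\<^sup>2 = 2 * (cmod (X$1))\<^sup>2 * Re (X$3) + 2 * Re (X$1 * cnj (X$2))"
  using assms cmod_minus_power2[of "X$1 + X$2" 1] cmod_plus_power2[of "X$1" "X$2"]
  by (simp add: real_part_eqn_def)

text \<open>
  If \<open>z1 = 0\<close> then \<open>X2 = - X1 X3\<close>, and substituting this into the formula for \<open>\<bar>z4\<bar>\<^sup>2\<close> gives \<open>z4 = 0\<close>.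
\<close>
lemma z1_nonzero:
  assumes "X \<in> Xstar_reg"
  shows "X$1 + X$2 / X$3 \<noteq> 0"
proof
  assume "X$1 + X$2 / X$3 = 0"
  then have "X$2 = - X$1 * X$3" using Xstar_reg_nonzero[OF assms] by (simp add: field_simps add_eq_0_iff2)
  then have "Re (X$1 * cnj (X$2)) = - (cmod (X$1))\<^sup>2 * Re (X$3)"
    unfolding cmod_power2 by (simp add: power2_eq_square algebra_simps)
  then have "(cmod (X$1 + X$2 - 1))\<^sup>2 = 0"
    using real_part_eqn_cmod_z4[of X] assms by (simp add: Xstar_reg_iff)
  then show False using assms by (simp add: Xstar_reg_iff)
qed

lemma J_coord_in_region: "X \<in> Xstar_reg \<Longrightarrow> J_coord X \<in> J_region"
  using z1_nonzero[of X] by (simp add: J_region_def J_coord_def Xstar_reg_iff diff_eq_eq)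

lemma J_param_J_coord:
  assumes X: "X \<in> Xstar_reg"
  shows "J_param (J_coord X) = X"
proof -
  define x z y z1 z4 where "x = X$1" and "z = X$3" and "y = X$2 / X$3" and "z1 = x + y" and "z4 = X$1 + X$2 - 1"
  define u where "u = x / z1"
  have nz: "x \<noteq> 0" "z \<noteq> 0" "X$2 \<noteq> 0" "z1 \<noteq> 0" "Im z \<noteq> 0"
    using Xstar_reg_nonzero[OF X] z1_nonzero[OF X] X by (auto simp: x_def z_def z1_def y_def Xstar_reg_iff)
  have x2: "X$2 = y * z" using nz by (simp add: y_def z_def)
  have w: "J_coord X = vector [z4 / z1, z]" by (simp add: J_coord_def z4_def z1_def x_def y_def z_def)
  have yx: "(cmod y)\<^sup>2 = (cmod x)\<^sup>2"
    using X nz by (simp add: Xstar_reg_iff modulus_eqn_def x_def[symmetric] z_def[symmetric] x2 norm_mult power_mult_distrib)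
  have y: "y = z1 * (1 - u)" "x = z1 * u" using nz by (simp_all add: u_def z1_def field_simps)
  have "(cmod (1 - u))\<^sup>2 = (cmod u)\<^sup>2" using yx nz unfolding y by (simp add: norm_mult power_mult_distrib)
  then have Re_u: "Re u = 1 / 2" unfolding cmod_power2 by (simp add: power2_eq_square algebra_simps)
  then have cu: "1 - u = cnj u" by (simp add: complex_eq_iff)
  have "(cmod z4)\<^sup>2 = 2 * (cmod x)\<^sup>2 * Re z + 2 * Re (x * cnj (y * z))"
    using real_part_eqn_cmod_z4[of X] X unfolding Xstar_reg_iff by (simp add: z4_def x_def z_def x2[symmetric, unfolded z_def])
  also have "\<dots> = 2 * Re (cnj z * x * cnj z1)"
    unfolding z1_def cmod_power2 by (simp add: power2_eq_square algebra_simps)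
  also have "cnj z * x * cnj z1 = of_real ((cmod z1)\<^sup>2) * (cnj z * u)"
    by (subst y(2)) (simp add: complex_norm_square del: of_real_power)
  finally have "(cmod z4)\<^sup>2 = (cmod z1)\<^sup>2 * (2 * Re (cnj z * u))" by simp
  then have "(cmod (z4 / z1))\<^sup>2 = 2 * Re (cnj z * u)" using nz by (simp add: norm_divide power_divide field_simps)
  also have "\<dots> = Re z + 2 * Im z * Im u" by (simp add: Re_u)
  finally have Im_u: "Im u = ((cmod (z4 / z1))\<^sup>2 - Re z) / (2 * Im z)" using nz by (simp add: field_simps)
  then have wt: "J_weight (J_coord X) = u"
    using Re_u by (simp add: J_weight_def w complex_eq_iff)
  have "z1 * (u + cnj u * z - z4 / z1) = x + y * z - z4"
    unfolding y cu[symmetric] using nz by (simp add: field_simps)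
  then have "z1 * (u + cnj u * z - z4 / z1) = 1" unfolding z4_def x2 by (simp add: x_def)
  then have "u + cnj u * z - z4 / z1 = 1 / z1"
    using nonzero_mult_div_cancel_left[OF nz(4), of "u + cnj u * z - z4 / z1"] by simp
  moreover have "J_denom (J_coord X) = u + cnj u * z - z4 / z1"
    unfolding J_denom_def wt by (simp add: w)
  ultimately have den: "J_denom (J_coord X) = 1 / z1" by simp
  have "u / (1 / z1) = X$1" using y(2) by (simp add: x_def mult.commute)
  moreover have "cnj u * z / (1 / z1) = X$2" unfolding x2 y(1) cu[symmetric] by simp
  moreover have "J_coord X $ 2 = X$3" by (simp add: w z_def)
  ultimately show ?thesis
    unfolding J_param_def wt den z_def by (intro vec3_eqI) simp_all
qed

text \<open>
  With \<open>d = u + cnj u z - w\<close> the left side of the second claim is \<open>\<bar>w\<bar>\<^sup>2 - \<bar>d + w\<bar>\<^sup>2\<close>, and both squares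
  can be expressed in \<open>u\<close> and \<open>z\<close>. The result \<open>- \<bar>u\<bar>\<^sup>2 \<bar>1 - z\<bar>\<^sup>2\<close> is nonzero because \<open>z\<close> is not
  real, whereas \<open>d = 0\<close> would make the left side vanish. Up to the factor \<open>\<bar>d\<bar>\<^sup>2\<close>, the second claim is the
  real-part equation at \<open>J_param y\<close>.
\<close>
lemma J_denom_nonzero:
  assumes "y \<in> J_region"
  shows "J_denom y \<noteq> 0" and "(cmod (J_denom y))\<^sup>2 - 2 * Re ((J_denom y + y$1) * cnj (J_denom y)) =
      - (cmod (J_weight y))\<^sup>2 * (1 + (cmod (y$2))\<^sup>2 - 2 * Re (y$2))"
proof -
  define u w z d where "u = J_weight y" and "w = y$1" and "z = y$2" and "d = J_denom y"
  have z: "Im z \<noteq> 0" using assms by (simp add: J_region_def z_def)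
  have Re_u: "Re u = 1 / 2" by (simp add: u_def J_weight_def)
  have "Im u = ((cmod w)\<^sup>2 - Re z) / (2 * Im z)" by (simp add: u_def J_weight_def w_def z_def)
  then have w2: "(cmod w)\<^sup>2 = Re z + 2 * Im z * Im u" using z by (simp add: field_simps)
  have dw: "d + w = u + cnj u * z" by (simp add: d_def J_denom_def u_def w_def z_def)
  have s2: "(cmod (d + w))\<^sup>2 = (cmod u)\<^sup>2 * (1 + (cmod z)\<^sup>2 - 2 * Re z) + (cmod w)\<^sup>2"
    unfolding dw w2 unfolding cmod_power2 by (simp add: Re_u power2_eq_square field_simps)
  have "(cmod d)\<^sup>2 - 2 * Re ((d + w) * cnj d) = (cmod w)\<^sup>2 - (cmod (d + w))\<^sup>2"
    unfolding cmod_power2 by (simp add: power2_eq_square algebra_simps)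
  then have eq: "(cmod d)\<^sup>2 - 2 * Re ((d + w) * cnj d) = - (cmod u)\<^sup>2 * (1 + (cmod z)\<^sup>2 - 2 * Re z)"
    using s2 by simp
  then show "(cmod (J_denom y))\<^sup>2 - 2 * Re ((J_denom y + y$1) * cnj (J_denom y)) =
      - (cmod (J_weight y))\<^sup>2 * (1 + (cmod (y$2))\<^sup>2 - 2 * Re (y$2))"
    by (simp add: u_def w_def z_def d_def)
  have "1 + (cmod z)\<^sup>2 - 2 * Re z = (cmod (z - 1))\<^sup>2"
    using cmod_minus_power2[of z 1] by simp
  moreover have "z \<noteq> 1" "u \<noteq> 0" using z Re_u by auto
  ultimately have "(cmod u)\<^sup>2 * (1 + (cmod z)\<^sup>2 - 2 * Re z) \<noteq> 0" by simp
  then show "J_denom y \<noteq> 0" using eq by (auto simp: d_def[symmetric])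
qed

lemma J_param_region:
  assumes y: "y \<in> J_region"
  shows "J_param y \<in> Xstar_reg" and "J_coord (J_param y) = y"
proof -
  define u w z d where "u = J_weight y" and "w = y$1" and "z = y$2" and "d = J_denom y"
  have z: "Im z \<noteq> 0" and w: "w \<noteq> 0" using y by (auto simp: J_region_def z_def w_def)
  have d: "d \<noteq> 0" using J_denom_nonzero[OF y] by (simp add: d_def)
  have Re_u: "Re u = 1 / 2" by (simp add: u_def J_weight_def)
  have uc: "u + cnj u = 1" using Re_u by (simp add: complex_eq_iff)
  have u: "u \<noteq> 0" using Re_u by auto
  have dw: "u + cnj u * z = d + w" by (simp add: d_def J_denom_def u_def w_def z_def)
  have X: "J_param y = vector [u / d, cnj u * z / d, z]"
    by (simp add: J_param_def u_def d_def z_def)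
  have z4: "u / d + cnj u * z / d - 1 = w / d"
    using dw d by (simp add: field_simps)
  have z1: "u / d + cnj u * z / d / z = 1 / d"
    using uc d z by (auto simp: add_divide_distrib[symmetric])
  have "J_coord (J_param y) = vector [w, z]"
    unfolding J_coord_def X using z1 z4 d by (simp add: mult_ac)
  then show "J_coord (J_param y) = y" by (auto intro!: vec2_eqI simp: w_def z_def)
  have "real_part_eqn (J_param y) = 0"
  proof -
    have eq: "(cmod d)\<^sup>2 - 2 * Re ((d + w) * cnj d) = - (cmod u)\<^sup>2 * (1 + (cmod z)\<^sup>2 - 2 * Re z)"
      using J_denom_nonzero(2)[OF y] by (simp add: u_def w_def z_def d_def)
    have "Re (u / d + cnj u * z / d) = Re ((d + w) * cnj d) / (cmod d)\<^sup>2"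
      unfolding add_divide_distrib[symmetric] dw by (simp add: Re_divide cmod_power2)
    then have "Re (u / d) + Re (cnj u * z / d) = Re ((d + w) * cnj d) / (cmod d)\<^sup>2" by simp
    moreover have "real_part_eqn (J_param y) = (cmod u)\<^sup>2 * (1 + (cmod z)\<^sup>2 - 2 * Re z) / (cmod d)\<^sup>2
        - 2 * (Re (u / d) + Re (cnj u * z / d)) + 1"
      unfolding real_part_eqn_def X using d
      by (simp add: norm_divide norm_mult power_divide power_mult_distrib add_divide_distrib diff_divide_distrib ring_distribs)
    ultimately have "real_part_eqn (J_param y) * (cmod d)\<^sup>2 = (cmod u)\<^sup>2 * (1 + (cmod z)\<^sup>2 - 2 * Re z)
        - 2 * Re ((d + w) * cnj d) + (cmod d)\<^sup>2"
      using d by (simp add: field_simps)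
    then have "real_part_eqn (J_param y) * (cmod d)\<^sup>2 = 0" using eq by linarith
    then show ?thesis using d by simp
  qed
  moreover have "modulus_eqn (J_param y) = 0"
    unfolding X modulus_eqn_def by (simp add: norm_divide norm_mult power_divide power_mult_distrib)
  moreover have "u / d + cnj u * z / d \<noteq> 1" using z4 w d by auto
  ultimately show "J_param y \<in> Xstar_reg"
    unfolding Xstar_reg_iff X using d u z by simp
qed

text \<open>
  The inverse of \<open>M_proj\<close>: the second equation is linear in \<open>Re X3\<close>, and then the first gives
  \<open>(Im X3)\<^sup>2\<close>, so the two signs of the square root correspond to the two charts of \<open>I\<close>.
\<close>
definition I_real_part :: "complex^2 \<Rightarrow> real" where
  "I_real_part y = ((cmod (y$1))\<^sup>2 + (cmod (y$2))\<^sup>2 - 2 * Re (y$1) - 2 * Re (y$2) + 1) / (2 * (cmod (y$1))\<^sup>2)"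

definition I_discriminant :: "complex^2 \<Rightarrow> real" where
  "I_discriminant y = (cmod (y$2))\<^sup>2 / (cmod (y$1))\<^sup>2 - (I_real_part y)\<^sup>2"

definition I_region :: "(complex^2) set" where
  "I_region = {y. y$1 \<noteq> 0 \<and> I_discriminant y > 0 \<and> y$1 + y$2 \<noteq> 1}"

definition I_param :: "real \<Rightarrow> complex^2 \<Rightarrow> complex^3" where
  "I_param s y = vector [y$1, y$2, Complex (I_real_part y) (s * sqrt (I_discriminant y))]"

lemma M_proj_nth [simp]: "M_proj X $ 1 = X $ 1" "M_proj X $ 2 = X $ 2"
  by (simp_all add: M_proj_def)

lemma Xstar_reg_M_proj:
  assumes X: "X \<in> Xstar_reg"
  shows "Re (X$3) = I_real_part (M_proj X)" "(Im (X$3))\<^sup>2 = I_discriminant (M_proj X)"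
proof -
  have x0: "(cmod (X$1))\<^sup>2 \<noteq> 0" using Xstar_reg_nonzero[OF X] by simp
  show R: "Re (X$3) = I_real_part (M_proj X)"
    using X x0 by (simp add: I_real_part_def Xstar_reg_iff real_part_eqn_def eq_divide_eq mult_ac)
  have "(cmod (X$3))\<^sup>2 = (cmod (X$2))\<^sup>2 / (cmod (X$1))\<^sup>2"
    using X x0 by (simp add: Xstar_reg_iff modulus_eqn_def eq_divide_eq mult_ac)
  then show "(Im (X$3))\<^sup>2 = I_discriminant (M_proj X)"
    using R by (simp add: I_discriminant_def cmod_power2[of "X$3"])
qed

lemma M_proj_in_region: "X \<in> Xstar_reg \<Longrightarrow> M_proj X \<in> I_region"
  using Xstar_reg_M_proj(2)[of X, symmetric] by (simp add: I_region_def Xstar_reg_iff)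

lemma I_param_M_proj:
  assumes "X \<in> Xstar_reg"
  shows "I_param (sgn (Im (X$3))) (M_proj X) = X"
proof -
  have "sqrt (I_discriminant (M_proj X)) = \<bar>Im (X$3)\<bar>"
    using Xstar_reg_M_proj(2)[OF assms] by (metis real_sqrt_abs)
  moreover have "sgn a * \<bar>a\<bar> = a" for a :: real by (simp add: sgn_if)
  ultimately show ?thesis
    using Xstar_reg_M_proj(1)[OF assms]
    by (intro vec3_eqI) (simp_all add: I_param_def complex_eq_iff)
qed

lemma I_param_region:
  assumes y: "y \<in> I_region" and s: "s\<^sup>2 = 1"
  shows "I_param s y \<in> Xstar_reg" "sgn (Im (I_param s y $ 3)) = s" "M_proj (I_param s y) = y"
proof -
  have y0: "y$1 \<noteq> 0" "I_discriminant y > 0" using y by (auto simp: I_region_def)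
  have s': "s = 1 \<or> s = -1" using s by (simp add: power2_eq_1_iff)
  have "(cmod (Complex (I_real_part y) (s * sqrt (I_discriminant y))))\<^sup>2 = (cmod (y$2))\<^sup>2 / (cmod (y$1))\<^sup>2"
    unfolding cmod_power2[of "Complex _ _"] using y0(2) s
    by (simp add: power_mult_distrib) (simp add: I_discriminant_def)
  then have "modulus_eqn (I_param s y) = 0" using y0 by (simp add: modulus_eqn_def I_param_def)
  moreover have "real_part_eqn (I_param s y) = 0"
    using y0 by (simp add: real_part_eqn_def I_param_def I_real_part_def)
  ultimately show "I_param s y \<in> Xstar_reg"
    using y s' unfolding Xstar_reg_iff by (auto simp: I_param_def I_region_def)
  show "sgn (Im (I_param s y $ 3)) = s" using s' y0 by (auto simp: I_param_def sgn_mult)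
  show "M_proj (I_param s y) = y" by (rule vec2_eqI) (simp_all add: I_param_def)
qed

section \<open>The two complex structures\<close>

lemma chart_by_inverse:
  assumes "\<phi> ` U \<subseteq> V" "\<psi> ` V \<subseteq> U"
    "\<And>x. x \<in> U \<Longrightarrow> \<psi> (\<phi> x) = x" "\<And>y. y \<in> V \<Longrightarrow> \<phi> (\<psi> y) = y"
    and \<psi>: "smooth_on V \<psi>"
  shows "inj_on \<phi> U" "\<phi> ` U = V" "\<And>y. y \<in> V \<Longrightarrow> inv_into U \<phi> y = \<psi> y"
    "smooth_on V (inv_into U \<phi>)"
proof -
  show inj: "inj_on \<phi> U" using assms(3) by (rule inj_on_inverseI)
  show "\<phi> ` U = V" using assms(1,2,4) by force
  show inv: "inv_into U \<phi> y = \<psi> y" if "y \<in> V" for y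
    using that inv_into_f_f[OF inj, of "\<psi> y"] assms(2,4) by auto
  show "smooth_on V (inv_into U \<phi>)" using \<psi> by (rule smooth_on_cong) (simp add: inv)
qed

lemma holomorphic_map_on_cong:
  assumes "open S" "holomorphic_map_on S f" "\<And>x. x \<in> S \<Longrightarrow> f x = g x"
  shows "holomorphic_map_on S g"
  unfolding holomorphic_map_on_def
proof
  fix x assume x: "x \<in> S"
  then obtain D where D: "(f has_derivative D) (at x)" "\<forall>c v. D (c *s v) = c *s D v"
    using assms(2) unfolding holomorphic_map_on_def by blast
  have "(g has_derivative D) (at x)"
    by (rule has_derivative_transform_within_open[OF D(1) assms(1) x assms(3)])
  then show "\<exists>D. (g has_derivative D) (at x) \<and> (\<forall>c v. D (c *s v) = c *s D v)" using D(2) by blast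
qed

lemma holomorphic_map_on_ident: "holomorphic_map_on S (\<lambda>x. x)"
  unfolding holomorphic_map_on_def by (auto intro!: exI[of _ "\<lambda>v. v"] has_derivative_ident)

lemmas has_derivative_vec_nth [derivative_intros] = bounded_linear.has_derivative[OF bounded_linear_vec_nth]

lemma smooth_map_on_restrict:
  assumes "smooth_on W f" "U \<subseteq> W" "\<And>x. x \<in> U \<Longrightarrow> f x = g x"
  shows "smooth_map_on U g"
  unfolding smooth_map_on_def using assms by blast

definition I_domain :: "real \<Rightarrow> (complex^3) set" where
  "I_domain s = {X \<in> Xstar_reg. sgn (Im (X$3)) = s}"

lemma I_reg_eq: "I_reg = {(I_domain 1, M_proj), (I_domain (-1), M_proj)}"
proof -
  have "Xstar_plus \<inter> Xstar_reg = I_domain 1" "Xstar_minus \<inter> Xstar_reg = I_domain (-1)"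
    by (auto simp: I_domain_def Xstar_plus_def Xstar_minus_def Xstar_reg_def sgn_if split: if_splits)
  then show ?thesis by (simp add: I_reg_def restrict_atlas_def I_atlas_def)
qed

lemma open_first_nonzero: "open {y :: complex^'n. y$i \<noteq> 0}"
  by (intro open_Collect_neq continuous_intros)

lemma smooth_on_I_real_part: "smooth_on {y. y$1 \<noteq> 0} I_real_part"
  unfolding I_real_part_def by (intro smooth_intros smooth_on_divide open_first_nonzero) auto

lemma smooth_on_I_discriminant: "smooth_on {y. y$1 \<noteq> 0} I_discriminant"
  unfolding I_discriminant_def
  by (intro smooth_intros smooth_on_divide smooth_on_I_real_part open_first_nonzero) auto

lemma open_I_region: "open I_region"
proof -
  have 1: "open ({y. y$1 \<noteq> 0} \<inter> I_discriminant -` {0<..})"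
    by (intro continuous_open_preimage smooth_on_continuous_on smooth_on_I_discriminant open_first_nonzero) auto
  have 2: "open {y :: complex^2. y$1 + y$2 \<noteq> 1}"
    by (intro open_Collect_neq continuous_intros)
  have "I_region = ({y. y$1 \<noteq> 0} \<inter> I_discriminant -` {0<..}) \<inter> {y. y$1 + y$2 \<noteq> 1}"
    by (auto simp: I_region_def)
  then show ?thesis using open_Int[OF 1 2] by (rule ssubst)
qed

lemma smooth_on_subset: "smooth_on S f \<Longrightarrow> open T \<Longrightarrow> T \<subseteq> S \<Longrightarrow> smooth_on T f"
  using smooth_on_comp_affine[of "\<lambda>x. x" T 0 S f] by (auto simp: bounded_linear_ident)

lemma smooth_on_I_param: "smooth_on I_region (I_param s)"
proof -
  have "I_region \<subseteq> {y. y$1 \<noteq> 0}" by (auto simp: I_region_def)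
  then have "smooth_on I_region I_real_part" "smooth_on I_region I_discriminant"
    by (rule smooth_on_subset[OF smooth_on_I_real_part open_I_region],
        rule smooth_on_subset[OF smooth_on_I_discriminant open_I_region])
  then show ?thesis
    unfolding I_param_def Complex_eq
    by (intro smooth_intros smooth_on_sqrt open_I_region) (auto simp: I_region_def)
qed

lemma I_chart:
  assumes s: "s\<^sup>2 = 1"
  shows "inj_on M_proj (I_domain s)" "M_proj ` I_domain s = I_region"
    "\<And>y. y \<in> I_region \<Longrightarrow> inv_into (I_domain s) M_proj y = I_param s y"
    "smooth_on I_region (inv_into (I_domain s) M_proj)"
proof -
  have a: "M_proj ` I_domain s \<subseteq> I_region" using M_proj_in_region by (auto simp: I_domain_def)
  have b: "I_param s ` I_region \<subseteq> I_domain s" using I_param_region[OF _ s] by (auto simp: I_domain_def)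
  have c: "\<And>x. x \<in> I_domain s \<Longrightarrow> I_param s (M_proj x) = x" using I_param_M_proj by (auto simp: I_domain_def)
  have d: "\<And>y. y \<in> I_region \<Longrightarrow> M_proj (I_param s y) = y" using I_param_region[OF _ s] by blast
  note * = chart_by_inverse[OF a b c d smooth_on_I_param]
  show "inj_on M_proj (I_domain s)" "M_proj ` I_domain s = I_region"
    "\<And>y. y \<in> I_region \<Longrightarrow> inv_into (I_domain s) M_proj y = I_param s y"
    "smooth_on I_region (inv_into (I_domain s) M_proj)"
    by (use * in blast)+
qed

lemma smooth_on_M_proj: "smooth_on UNIV M_proj"
  unfolding M_proj_def by (intro smooth_intros open_UNIV)

lemma complex_structure_I_reg: "complex_structure Xstar_reg I_reg"
proof -
  have dom: "openin (top_of_set Xstar_reg) (I_domain s)" if "s = 1 \<or> s = -1" for s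
  proof -
    have "open {X :: complex^3. s * Im (X$3) > 0}"
      by (intro open_Collect_less continuous_intros)
    moreover have "I_domain s = Xstar_reg \<inter> {X. s * Im (X$3) > 0}"
      using that by (auto simp: I_domain_def sgn_if split: if_splits)
    ultimately show ?thesis by (auto simp: openin_open)
  qed
  have cover: "I_domain 1 \<union> I_domain (-1) = Xstar_reg"
    by (auto simp: I_domain_def Xstar_reg_iff sgn_if)
  have chart: "openin (top_of_set Xstar_reg) (I_domain s) \<and> inj_on M_proj (I_domain s) \<and>
      open (M_proj ` I_domain s) \<and> smooth_map_on (I_domain s) M_proj \<and>
      smooth_on (M_proj ` I_domain s) (inv_into (I_domain s) M_proj)" if "s = 1 \<or> s = -1" for s
  proof -
    have s2: "s\<^sup>2 = 1" using that by auto
    show ?thesis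
      using dom[OF that] I_chart[OF s2] open_I_region smooth_map_on_restrict[OF smooth_on_M_proj, of "I_domain s" M_proj]
      by simp
  qed
  have disj: "I_domain 1 \<inter> I_domain (-1) = {}" "I_domain (-1) \<inter> I_domain 1 = {}" by (auto simp: I_domain_def)
  have hol: "holomorphic_map_on (M_proj ` I_domain s) (M_proj \<circ> inv_into (I_domain s) M_proj)"
    if "s = 1 \<or> s = -1" for s
  proof (rule holomorphic_map_on_cong[OF _ holomorphic_map_on_ident])
    show "open (M_proj ` I_domain s)" using chart[OF that] by blast
  qed (metis comp_apply f_inv_into_f)
  have empty: "holomorphic_map_on {} f" for f :: "complex^2 \<Rightarrow> complex^2" by (simp add: holomorphic_map_on_def)
  show ?thesis
    unfolding complex_structure_def I_reg_eq using cover chart hol disj empty by auto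
qed

lemma proj_point_eq_1: 
  assumes "a \<noteq> 0" shows "proj_point a b = proj_point 1 w \<longleftrightarrow> w = b / a"
proof
  assume "proj_point a b = proj_point 1 w"
  moreover have "vector [a, b] \<in> proj_point a b" unfolding proj_point_def by (rule range_eqI[of _ _ 1]) simp
  ultimately obtain c where "vector [a, b] = c *s (vector [1, w] :: complex^2)" unfolding proj_point_def by blast
  then show "w = b / a" using assms by (simp add: vec_eq_iff forall_2)
next
  assume w: "w = b / a"
  have 1: "c *s vector [a, b] = (c * a) *s (vector [1, w] :: complex^2)" for c
    using assms by (simp add: w vec_eq_iff forall_2)
  have 2: "c *s (vector [1, w] :: complex^2) = (c / a) *s vector [a, b]" for c
    using assms by (simp add: w vec_eq_iff forall_2)
  show "proj_point a b = proj_point 1 w"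
    unfolding proj_point_def using 1 2 by (metis (no_types, lifting) image_cong image_subset_iff rangeI subset_antisym)
qed

lemma proj_point_eq_2: 
  assumes "b \<noteq> 0" shows "proj_point a b = proj_point w 1 \<longleftrightarrow> w = a / b"
proof
  assume "proj_point a b = proj_point w 1"
  moreover have "vector [a, b] \<in> proj_point a b" unfolding proj_point_def by (rule range_eqI[of _ _ 1]) simp
  ultimately obtain c where "vector [a, b] = c *s (vector [w, 1] :: complex^2)" unfolding proj_point_def by blast
  then show "w = a / b" using assms by (simp add: vec_eq_iff forall_2)
next
  assume w: "w = a / b"
  have 1: "c *s vector [a, b] = (c * b) *s (vector [w, 1] :: complex^2)" for c
    using assms by (simp add: w vec_eq_iff forall_2)
  have 2: "c *s (vector [w, 1] :: complex^2) = (c / b) *s vector [a, b]" for c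
    using assms by (simp add: w vec_eq_iff forall_2)
  show "proj_point a b = proj_point w 1"
    unfolding proj_point_def using 1 2 by (metis (no_types, lifting) image_cong image_subset_iff rangeI subset_antisym)
qed

definition J_chart1 :: "complex^3 \<Rightarrow> complex^2" where
  "J_chart1 = (\<lambda>(L, z). vector [THE w. L = proj_point 1 w, z]) \<circ> N_map"

definition J_chart2 :: "complex^3 \<Rightarrow> complex^2" where
  "J_chart2 = (\<lambda>(L, z). vector [THE w. L = proj_point w 1, z]) \<circ> N_map"

text \<open>The transition between the two affine charts of the projective line.\<close>
definition swap_chart :: "complex^2 \<Rightarrow> complex^2" where
  "swap_chart y = vector [1 / y$1, y$2]"

lemma Xstar_reg_z:
  assumes "X \<in> Xstar_reg"
  shows "X$1 + X$2 / X$3 \<noteq> 0" "X$1 + X$2 - 1 \<noteq> 0"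
  using z1_nonzero[OF assms] assms by (auto simp: Xstar_reg_iff)

lemma N_map_Xstar_reg:
  "X \<in> Xstar_reg \<Longrightarrow> N_map X = (proj_point (X$1 + X$2 / X$3) (X$1 + X$2 - 1), X$3)"
  using Xstar_reg_z[of X] by (simp add: N_map_def Let_def)

lemma J_chart1_eq: "X \<in> Xstar_reg \<Longrightarrow> J_chart1 X = J_coord X"
  using Xstar_reg_z[of X] by (simp add: J_chart1_def J_coord_def N_map_Xstar_reg proj_point_eq_1)

lemma J_chart2_eq: "X \<in> Xstar_reg \<Longrightarrow> J_chart2 X = swap_chart (J_coord X)"
  using Xstar_reg_z[of X]
  by (simp add: J_chart2_def J_coord_def swap_chart_def N_map_Xstar_reg proj_point_eq_2)

text \<open>Both homogeneous coordinates are nonzero on the regular part, so each chart is defined on all of it.\<close>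
lemma J_reg_eq: "J_reg = {(Xstar_reg, J_chart1), (Xstar_reg, J_chart2)}"
proof -
  have N: "N_map X \<in> {proj_point 1 w | w. True} \<times> (- \<real>) \<and> N_map X \<in> {proj_point w 1 | w. True} \<times> (- \<real>)"
    if "X \<in> Xstar_reg" for X
    using Xstar_reg_z[OF that] proj_point_eq_1 proj_point_eq_2 that
    unfolding N_map_Xstar_reg[OF that] by (auto simp: complex_is_Real_iff Xstar_reg_iff)
  have "(Xstar \<inter> N_map -` ({proj_point 1 w | w. True} \<times> (- \<real>))) \<inter> Xstar_reg = Xstar_reg"
    "(Xstar \<inter> N_map -` ({proj_point w 1 | w. True} \<times> (- \<real>))) \<inter> Xstar_reg = Xstar_reg"
    using N by (auto simp: Xstar_reg_def)
  then show ?thesis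
    by (simp add: J_reg_def restrict_atlas_def J_atlas_def pullback_atlas_def CP1_times_nonreal_atlas_def
        J_chart1_def J_chart2_def)
qed

lemma open_J_region: "open J_region"
proof -
  have "J_region = {y. y$1 \<noteq> 0} \<inter> {y. Im (y$2) \<noteq> 0}" by (auto simp: J_region_def)
  moreover have "open ({y :: complex^2. y$1 \<noteq> 0} \<inter> {y. Im (y$2) \<noteq> 0})"
    by (intro open_Int open_Collect_neq continuous_intros)
  ultimately show ?thesis by (rule ssubst)
qed

lemma swap_chart_region: "y \<in> J_region \<Longrightarrow> swap_chart y \<in> J_region"
  "swap_chart (swap_chart y) = y"
  by (auto simp: J_region_def swap_chart_def intro!: vec2_eqI)

lemma smooth_on_J_param:
  assumes f: "smooth_on S f" and r: "\<And>x. x \<in> S \<Longrightarrow> f x \<in> J_region"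
  shows "smooth_on S (\<lambda>x. J_param (f x))"
proof -
  have nz: "2 * Im (f x $ 2) \<noteq> 0" "J_denom (f x) \<noteq> 0" if "x \<in> S" for x
    using r[OF that] J_denom_nonzero(1)[OF r[OF that]] by (auto simp: J_region_def)
  have w: "smooth_on S (\<lambda>x. J_weight (f x))"
    unfolding J_weight_def Complex_eq
    by (intro smooth_intros smooth_on_divide f smooth_on_open[OF f]) (use nz in auto)
  have d: "smooth_on S (\<lambda>x. J_denom (f x))"
    unfolding J_denom_def by (intro smooth_intros w f)
  show ?thesis
    unfolding J_param_def by (intro smooth_intros smooth_on_divide w d f) (use nz in auto)
qed

lemma smooth_on_swap_chart: "smooth_on J_region swap_chart"
  unfolding swap_chart_def
  by (intro smooth_intros smooth_on_divide open_J_region) (auto simp: J_region_def)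

lemma smooth_map_on_J_coord:
  shows "smooth_map_on Xstar_reg J_coord" "smooth_map_on Xstar_reg (\<lambda>X. swap_chart (J_coord X))"
proof -
  \<comment> \<open>An open set of the ambient space on which both coordinate formulas have nonzero denominators.\<close>
  define W :: "(complex^3) set" where "W = {X. X$3 \<noteq> 0} \<inter> {X. X$1 * X$3 + X$2 \<noteq> 0} \<inter> {X. X$1 + X$2 - 1 \<noteq> 0}"
  have W: "open W" unfolding W_def by (intro open_Int open_Collect_neq continuous_intros)
  have z: "X$3 \<noteq> 0" "X$1 + X$2 / X$3 \<noteq> 0" "X$1 + X$2 - 1 \<noteq> 0" if "X \<in> W" for X
    using that by (auto simp: W_def add_divide_eq_iff)
  have sub: "Xstar_reg \<subseteq> W"
    using Xstar_reg_z Xstar_reg_nonzero by (auto simp: W_def add_divide_eq_iff)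
  have "smooth_on W J_coord"
    unfolding J_coord_def by (intro smooth_intros smooth_on_divide W) (use z in auto)
  then show "smooth_map_on Xstar_reg J_coord" using sub by (rule smooth_map_on_restrict) simp
  have "smooth_on W (\<lambda>X. swap_chart (J_coord X))"
    unfolding J_coord_def swap_chart_def vector_2
    by (intro smooth_intros smooth_on_divide W) (use z in auto)
  then show "smooth_map_on Xstar_reg (\<lambda>X. swap_chart (J_coord X))" using sub by (rule smooth_map_on_restrict) simp
qed

lemma smooth_map_on_cong: "smooth_map_on U f \<Longrightarrow> (\<And>x. x \<in> U \<Longrightarrow> f x = g x) \<Longrightarrow> smooth_map_on U g"
  unfolding smooth_map_on_def by (metis IntD1)

lemma J_charts:
  shows "inj_on J_chart1 Xstar_reg" "J_chart1 ` Xstar_reg = J_region"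
    "\<And>y. y \<in> J_region \<Longrightarrow> inv_into Xstar_reg J_chart1 y = J_param y"
    "smooth_on J_region (inv_into Xstar_reg J_chart1)" "smooth_map_on Xstar_reg J_chart1"
    and "inj_on J_chart2 Xstar_reg" "J_chart2 ` Xstar_reg = J_region"
    "\<And>y. y \<in> J_region \<Longrightarrow> inv_into Xstar_reg J_chart2 y = J_param (swap_chart y)"
    "smooth_on J_region (inv_into Xstar_reg J_chart2)" "smooth_map_on Xstar_reg J_chart2"
proof -
  have a: "J_chart1 ` Xstar_reg \<subseteq> J_region" using J_coord_in_region J_chart1_eq by auto
  have b: "J_param ` J_region \<subseteq> Xstar_reg" using J_param_region by auto
  have c: "\<And>x. x \<in> Xstar_reg \<Longrightarrow> J_param (J_chart1 x) = x" by (simp add: J_chart1_eq J_param_J_coord)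
  have d: "\<And>y. y \<in> J_region \<Longrightarrow> J_chart1 (J_param y) = y" by (simp add: J_chart1_eq J_param_region)
  have e: "smooth_on J_region J_param"
    using smooth_on_J_param[OF smooth_on_ident[OF open_J_region]] by simp
  note * = chart_by_inverse[OF a b c d e]
  show "inj_on J_chart1 Xstar_reg" "J_chart1 ` Xstar_reg = J_region"
    "\<And>y. y \<in> J_region \<Longrightarrow> inv_into Xstar_reg J_chart1 y = J_param y"
    "smooth_on J_region (inv_into Xstar_reg J_chart1)"
    by (use * in blast)+
  show "smooth_map_on Xstar_reg J_chart1"
    using smooth_map_on_J_coord(1) by (rule smooth_map_on_cong) (simp add: J_chart1_eq)
next
  have a: "J_chart2 ` Xstar_reg \<subseteq> J_region" using J_coord_in_region J_chart2_eq swap_chart_region by auto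
  have b: "(\<lambda>y. J_param (swap_chart y)) ` J_region \<subseteq> Xstar_reg" using J_param_region swap_chart_region by auto
  have c: "\<And>x. x \<in> Xstar_reg \<Longrightarrow> J_param (swap_chart (J_chart2 x)) = x"
    by (simp add: J_chart2_eq swap_chart_region J_param_J_coord)
  have d: "\<And>y. y \<in> J_region \<Longrightarrow> J_chart2 (J_param (swap_chart y)) = y"
    by (simp add: J_chart2_eq J_param_region swap_chart_region)
  have e: "smooth_on J_region (\<lambda>y. J_param (swap_chart y))"
    by (rule smooth_on_J_param[OF smooth_on_swap_chart swap_chart_region(1)])
  note * = chart_by_inverse[OF a b c d e]
  show "inj_on J_chart2 Xstar_reg" "J_chart2 ` Xstar_reg = J_region"
    "\<And>y. y \<in> J_region \<Longrightarrow> inv_into Xstar_reg J_chart2 y = J_param (swap_chart y)"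
    "smooth_on J_region (inv_into Xstar_reg J_chart2)"
    by (use * in blast)+
  show "smooth_map_on Xstar_reg J_chart2"
    using smooth_map_on_J_coord(2) by (rule smooth_map_on_cong) (simp add: J_chart2_eq)
qed

lemma holomorphic_swap_chart: "holomorphic_map_on J_region swap_chart"
  unfolding holomorphic_map_on_def
proof
  fix y assume y: "y \<in> J_region"
  let ?D = "\<lambda>v :: complex^2. vector [- (inverse (y$1) * v$1 * inverse (y$1)), v$2] :: complex^2"
  have nth: "((\<lambda>y. y$i) has_derivative (\<lambda>v. v$i)) (at y)" for i
    by (rule has_derivative_vec_nth[OF has_derivative_ident])
  have "y$1 \<noteq> 0" using y by (simp add: J_region_def)
  then have "((\<lambda>y. vector [inverse (y$1), y$2] :: complex^2) has_derivative ?D) (at y)"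
    by (rule has_derivative_vector_2[OF Deriv.has_derivative_inverse[OF _ nth] nth])
  then have "(swap_chart has_derivative ?D) (at y)"
    by (simp only: swap_chart_def[abs_def] divide_inverse mult_1_left)
  moreover have "\<forall>c v. ?D (c *s v) = c *s ?D v" by (auto intro!: vec2_eqI)
  ultimately show "\<exists>D. (swap_chart has_derivative D) (at y) \<and> (\<forall>c v. D (c *s v) = c *s D v)" by blast
qed

lemma complex_structure_J_reg: "complex_structure Xstar_reg J_reg"
proof -
  have 11: "holomorphic_map_on J_region (J_chart1 \<circ> inv_into Xstar_reg J_chart1)"
    by (rule holomorphic_map_on_cong[OF open_J_region holomorphic_map_on_ident])
      (simp add: J_charts J_chart1_eq J_param_region)
  have 22: "holomorphic_map_on J_region (J_chart2 \<circ> inv_into Xstar_reg J_chart2)"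
    by (rule holomorphic_map_on_cong[OF open_J_region holomorphic_map_on_ident])
      (simp add: J_charts J_chart2_eq J_param_region swap_chart_region)
  have 12: "holomorphic_map_on J_region (J_chart2 \<circ> inv_into Xstar_reg J_chart1)"
    by (rule holomorphic_map_on_cong[OF open_J_region holomorphic_swap_chart])
      (simp add: J_charts J_chart2_eq J_param_region)
  have 21: "holomorphic_map_on J_region (J_chart1 \<circ> inv_into Xstar_reg J_chart2)"
    by (rule holomorphic_map_on_cong[OF open_J_region holomorphic_swap_chart])
      (simp add: J_charts J_chart1_eq J_param_region swap_chart_region)
  show ?thesis
    unfolding complex_structure_def J_reg_eq using 11 12 21 22 J_charts open_J_region by simp
qed

section \<open>The tangent bundle and the horizontal and vertical bundles\<close>

text \<open>
  The \<open>(1,0)\<close>-parts of the differentials of \<open>modulus_eqn\<close> and \<open>real_part_eqn\<close>: the differentials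
  themselves are twice their real parts. This makes the maximal complex subspace of the tangent space
  visible as the common complex kernel.
\<close>
definition del_modulus :: "complex^3 \<Rightarrow> complex^3 \<Rightarrow> complex" where
  "del_modulus p v = cnj (p$1) * (p$3 * cnj (p$3)) * v$1 - cnj (p$2) * v$2 + p$1 * cnj (p$1) * cnj (p$3) * v$3"

definition del_real_part :: "complex^3 \<Rightarrow> complex^3 \<Rightarrow> complex" where
  "del_real_part p v = (cnj (p$1) - 1 - cnj (p$1) * (p$3 + cnj (p$3))) * v$1 + (cnj (p$2) - 1) * v$2
     - p$1 * cnj (p$1) * v$3"

lemma del_linear:
  "del_modulus p (v + w) = del_modulus p v + del_modulus p w" "del_real_part p (v + w) = del_real_part p v + del_real_part p w"
  "del_modulus p (v - w) = del_modulus p v - del_modulus p w" "del_real_part p (v - w) = del_real_part p v - del_real_part p w"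
  "del_modulus p (c *s v) = c * del_modulus p v" "del_real_part p (c *s v) = c * del_real_part p v"
  by (simp_all add: del_modulus_def del_real_part_def algebra_simps)

lemma has_derivative_modulus_eqn:
  "(modulus_eqn has_derivative (\<lambda>v. 2 * Re (del_modulus p v))) (at p)"
  unfolding modulus_eqn_def[abs_def] cmod_power2
  by (rule derivative_eq_intros refl)+
    (simp add: fun_eq_iff del_modulus_def power2_eq_square algebra_simps)

lemma has_derivative_real_part_eqn:
  "(real_part_eqn has_derivative (\<lambda>v. 2 * Re (del_real_part p v))) (at p)"
  unfolding real_part_eqn_def[abs_def] cmod_power2
  by (rule derivative_eq_intros refl)+
    (simp add: fun_eq_iff del_real_part_def power2_eq_square algebra_simps)

lemma tangent_vector_del:
  assumes "v \<in> tangent_space \<XX> p"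
  shows "Re (del_modulus p v) = 0" "Re (del_real_part p v) = 0"
proof -
  obtain e \<gamma> where \<gamma>: "e > 0" "\<gamma> ` {-e<..<e} \<subseteq> \<XX>" "\<gamma> 0 = p" "(\<gamma> has_vector_derivative v) (at (0::real))"
    using assms unfolding tangent_space_def by blast
  have "2 * Re (L v) = 0"
    if f: "(f has_derivative (\<lambda>v. 2 * Re (L v))) (at p)" and z: "\<And>X. X \<in> \<XX> \<Longrightarrow> f X = (0::real)" for f L
  proof -
    have "((\<lambda>t. f (\<gamma> t)) has_vector_derivative 2 * Re (L v)) (at 0)"
      by (rule has_vector_derivative_chart_curve[OF has_derivative_at_withinI[OF f] \<gamma>])
    then have "((\<lambda>t. 0::real) has_vector_derivative 2 * Re (L v)) (at 0)"
      by (rule has_vector_derivative_transform_within_open[where S = "{-e<..<e}"])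
        (use \<gamma>(1,2) z in \<open>auto simp: image_subset_iff\<close>)
    then show ?thesis
      using vector_derivative_unique_at[OF _ has_vector_derivative_const] by blast
  qed
  note * = this[OF has_derivative_modulus_eqn] this[OF has_derivative_real_part_eqn]
  show "Re (del_modulus p v) = 0" "Re (del_real_part p v) = 0"
    using * by (auto simp: cross_ratio_variety_iff)
qed

text \<open>
  For \<open>v1 = v2 = 0\<close> the linearised equations say that \<open>Re v3\<close> and \<open>Re (cnj X3 v3)\<close> vanish, which
  forces \<open>v3 = 0\<close> since \<open>X3\<close> is not real.
\<close>
lemma tangent_third_determined:
  assumes p: "p \<in> Xstar_reg" and v: "Re (del_modulus p v) = 0" "Re (del_real_part p v) = 0"
    and w: "Re (del_modulus p w) = 0" "Re (del_real_part p w) = 0" and eq: "v$1 = w$1" "v$2 = w$2"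
  shows "v = w"
proof -
  define c where "c = v$3 - w$3"
  have n: "p$1 \<noteq> 0" "Im (p$3) \<noteq> 0" using p by (auto simp: Xstar_reg_iff)
  have 1: "del_modulus p v - del_modulus p w = of_real ((cmod (p$1))\<^sup>2) * (cnj (p$3) * c)"
    unfolding complex_norm_square by (simp add: del_modulus_def eq c_def algebra_simps)
  have 2: "del_real_part p v - del_real_part p w = - (of_real ((cmod (p$1))\<^sup>2) * c)"
    unfolding complex_norm_square by (simp add: del_real_part_def eq c_def algebra_simps)
  have "Re (of_real ((cmod (p$1))\<^sup>2) * c) = 0" using v w arg_cong[OF 2, of Re] by simp
  then have c1: "Re c = 0" using n by simp
  have "Re (of_real ((cmod (p$1))\<^sup>2) * (cnj (p$3) * c)) = 0" using v w arg_cong[OF 1, of Re] by simp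
  then have "Re (cnj (p$3) * c) = 0" using n by simp
  then have "Im c = 0" using c1 n by simp
  then have "v$3 = w$3" using c1 by (simp add: c_def complex_eq_iff)
  then show ?thesis using eq by (intro vec3_eqI)
qed

lemma tangent_space_mono: "S \<subseteq> T \<Longrightarrow> tangent_space S p \<subseteq> tangent_space T p"
  unfolding tangent_space_def by blast

lemma Xstar_reg_subset: "Xstar_reg \<subseteq> \<XX>"
  by (auto simp: Xstar_reg_iff cross_ratio_variety_iff)

text \<open>Lift a straight line in the chart \<open>(X1, X2)\<close>.\<close>
lemma tangent_vector_exists:
  assumes p: "p \<in> Xstar_reg"
  obtains v where "v \<in> tangent_space Xstar_reg p" "v$1 = a" "v$2 = b"
proof -
  define s where "s = sgn (Im (p$3))"
  have s: "s\<^sup>2 = 1" using p by (auto simp: s_def sgn_if Xstar_reg_iff)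
  define L :: "real \<Rightarrow> complex^2" where "L = (\<lambda>t. t *\<^sub>R vector [a, b])"
  have L: "bounded_linear L" unfolding L_def by (rule bounded_linear_scaleR_left)
  have "open ((\<lambda>t. M_proj p + L t) -` I_region)"
    unfolding L_def by (intro open_vimage open_I_region continuous_intros)
  moreover have "0 \<in> (\<lambda>t. M_proj p + L t) -` I_region"
    using M_proj_in_region[OF p] by (simp add: L_def)
  ultimately obtain e where e: "e > 0" "ball 0 e \<subseteq> (\<lambda>t. M_proj p + L t) -` I_region"
    by (auto elim: openE)
  have reg: "M_proj p + L t \<in> I_region" if "t \<in> {-e<..<e}" for t
    using that e(2) by (auto simp: subset_iff dist_real_def)
  define \<gamma> where "\<gamma> = (\<lambda>t. I_param s (M_proj p + L t))"
  have sm: "smooth_on {-e<..<e} \<gamma>"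
    unfolding \<gamma>_def by (rule smooth_on_comp_affine[OF L reg _ smooth_on_I_param]) auto
  have im: "\<gamma> ` {-e<..<e} \<subseteq> Xstar_reg" using reg I_param_region(1)[OF _ s] by (auto simp: \<gamma>_def)
  have \<gamma>0: "\<gamma> 0 = p" using I_param_M_proj[OF p] by (simp add: \<gamma>_def L_def s_def)
  obtain D where D: "(\<gamma> has_derivative D) (at 0)"
    using smooth_on_has_derivative[OF sm, of 0] e(1) by auto
  define v where "v = D 1"
  have v: "(\<gamma> has_vector_derivative v) (at 0)"
  proof -
    have "h *\<^sub>R D 1 = D h" for h
      using linear_scale[OF has_derivative_linear[OF D], of h 1] by simp
    then have eq: "(\<lambda>h. h *\<^sub>R D 1) = D" by (rule ext)
    show ?thesis unfolding has_vector_derivative_def v_def eq by (rule D)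
  qed
  have "v \<in> tangent_space Xstar_reg p"
    unfolding tangent_space_def using e(1) sm im \<gamma>0 v by blast
  moreover have "M_proj v = vector [a, b]"
  proof -
    have "bounded_linear M_proj"
      unfolding M_proj_def vector_2_axis
      by (intro bounded_linear_add bounded_linear_compose[OF bounded_linear_axis bounded_linear_vec_nth])
    from bounded_linear.has_vector_derivative[OF this v]
    have "((\<lambda>t. M_proj (\<gamma> t)) has_vector_derivative M_proj v) (at 0)" .
    then have "((\<lambda>t. M_proj p + L t) has_vector_derivative M_proj v) (at 0)"
      by (rule has_vector_derivative_transform_within_open[where S = "{-e<..<e}"])
        (use e(1) reg I_param_region(3)[OF _ s] in \<open>auto simp: \<gamma>_def\<close>)
    moreover have "((\<lambda>t. M_proj p + L t) has_vector_derivative vector [a, b]) (at 0)"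
      unfolding L_def by (auto intro!: derivative_eq_intros)
    ultimately show ?thesis by (rule vector_derivative_unique_at)
  qed
  then have "v$1 = a" "v$2 = b" by (metis M_proj_nth vector_2)+
  ultimately show thesis by (rule that)
qed

text \<open>
  Tangent vectors of \<open>\<XX>\<close> satisfy the linearised equations; conversely a solution has the same first
  two components as some tangent vector of the regular part, hence equals it. In particular both sets have
  the same tangent space at regular points, so \<open>H_bundle\<close> may be computed in the regular part.
\<close>
lemma tangent_space_iff:
  assumes p: "p \<in> Xstar_reg"
  shows "v \<in> tangent_space Xstar_reg p \<longleftrightarrow> Re (del_modulus p v) = 0 \<and> Re (del_real_part p v) = 0"
    and "tangent_space \<XX> p = tangent_space Xstar_reg p"
proof -
  have 1: "v \<in> tangent_space Xstar_reg p" if "Re (del_modulus p v) = 0 \<and> Re (del_real_part p v) = 0" for v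
  proof -
    obtain w where w: "w \<in> tangent_space Xstar_reg p" "w$1 = v$1" "w$2 = v$2"
      using tangent_vector_exists[OF p] by blast
    moreover have "w \<in> tangent_space \<XX> p" using tangent_space_mono[OF Xstar_reg_subset] w(1) by blast
    ultimately have "v = w" using tangent_third_determined[OF p] tangent_vector_del that by metis
    then show ?thesis using w(1) by simp
  qed
  then show "v \<in> tangent_space Xstar_reg p \<longleftrightarrow> Re (del_modulus p v) = 0 \<and> Re (del_real_part p v) = 0"
    using tangent_space_mono[OF Xstar_reg_subset] tangent_vector_del by blast
  show "tangent_space \<XX> p = tangent_space Xstar_reg p"
    using 1 tangent_space_mono[OF Xstar_reg_subset] tangent_vector_del by blast
qed

text \<open>
  The differentials are already independent on vectors \<open>(0, 0, z)\<close>, where they are proportional to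
  \<open>Re (cnj X3 z)\<close> and \<open>Re z\<close>.
\<close>
lemma smooth_submanifold_Xstar_reg: "smooth_submanifold 4 Xstar_reg"
  unfolding smooth_submanifold_def
proof (intro conjI ballI)
  show "4 \<le> DIM(complex^3)" by simp
  fix p assume p: "p \<in> Xstar_reg"
  define U :: "(complex^3) set" where "U = {X. X$1 \<noteq> 0} \<inter> {X. Im (X$3) \<noteq> 0} \<inter> {X. X$1 + X$2 \<noteq> 1}"
  define f :: "nat \<Rightarrow> complex^3 \<Rightarrow> real" where "f = (\<lambda>i. if i = 0 then modulus_eqn else real_part_eqn)"
  have U: "open U" unfolding U_def by (intro open_Int open_Collect_neq continuous_intros)
  have all2: "(\<forall>i<DIM(complex^3) - 4. P i) \<longleftrightarrow> P 0 \<and> P 1" for P :: "nat \<Rightarrow> bool"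
    by (auto simp: less_Suc_eq numeral_2_eq_2)
  have sum2: "(\<Sum>i<DIM(complex^3) - 4. g i) = g 0 + g 1" for g :: "nat \<Rightarrow> real"
    by (simp add: numeral_2_eq_2)
  have sm: "smooth_on U modulus_eqn" "smooth_on U real_part_eqn"
    unfolding modulus_eqn_def real_part_eqn_def by (intro smooth_intros U)+
  have fd: "frechet_derivative modulus_eqn (at p) = (\<lambda>v. 2 * Re (del_modulus p v))"
    "frechet_derivative real_part_eqn (at p) = (\<lambda>v. 2 * Re (del_real_part p v))"
    using frechet_derivative_at[OF has_derivative_modulus_eqn] frechet_derivative_at[OF has_derivative_real_part_eqn]
    by metis+
  have ind: "c 0 = 0 \<and> c 1 = 0"
    if c: "\<forall>v. c 0 * (2 * Re (del_modulus p v)) + c 1 * (2 * Re (del_real_part p v)) = 0" for c :: "nat \<Rightarrow> real"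
  proof -
    have n: "(cmod (p$1))\<^sup>2 \<noteq> 0" "Im (p$3) \<noteq> 0" using p by (auto simp: Xstar_reg_iff)
    have t: "Re (del_modulus p (vector [0, 0, z])) = (cmod (p$1))\<^sup>2 * Re (cnj (p$3) * z)"
      "Re (del_real_part p (vector [0, 0, z])) = - (cmod (p$1))\<^sup>2 * Re z" for z
      unfolding cmod_power2 by (simp_all add: del_modulus_def del_real_part_def power2_eq_square algebra_simps)
    \<comment> \<open>On \<open>(0, 0, \<i>)\<close> the second differential vanishes, and the first does not since \<open>Im X3 \<noteq> 0\<close>.\<close>
    have c0: "c 0 = 0" using c[rule_format, of "vector [0, 0, \<i>]"] n unfolding t by simp
    then have "c 1 = 0" using c[rule_format, of "vector [0, 0, 1]"] n unfolding t by simp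
    with c0 show ?thesis by simp
  qed
  show "\<exists>U f. p \<in> U \<and> open U \<and> (\<forall>i<DIM(complex^3) - 4. smooth_on U (f i)) \<and>
        Xstar_reg \<inter> U = {x\<in>U. \<forall>i<DIM(complex^3) - 4. f i x = 0} \<and>
        (\<forall>c. (\<forall>v. (\<Sum>i<DIM(complex^3) - 4. c i * frechet_derivative (f i) (at p) v) = 0)
              \<longrightarrow> (\<forall>i<DIM(complex^3) - 4. c i = (0::real)))"
    unfolding all2 sum2
  proof (intro exI[of _ U] exI[of _ f] conjI allI impI)
    show "p \<in> U" "Xstar_reg \<inter> U = {x \<in> U. f 0 x = 0 \<and> f 1 x = 0}"
      using p by (auto simp: U_def f_def Xstar_reg_iff)
    show "open U" "smooth_on U (f 0)" "smooth_on U (f 1)" using U sm by (simp_all add: f_def)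
    fix c :: "nat \<Rightarrow> real"
    assume "\<forall>v. c 0 * frechet_derivative (f 0) (at p) v + c 1 * frechet_derivative (f 1) (at p) v = 0"
    then have "\<forall>v. c 0 * (2 * Re (del_modulus p v)) + c 1 * (2 * Re (del_real_part p v)) = 0"
      by (simp add: f_def fd)
    then show "c 0 = 0" "c 1 = 0" using ind by blast+
  qed
qed

text \<open>
  Up to a nonvanishing factor the cross product of the covectors \<open>del_modulus\<close> and
  \<open>del_real_part\<close>, simplified by means of the equations of the variety. The factor \<open>X1\<close> clears
  the denominator in the generator \<open>Z\<close> and makes the field polynomial in the coordinates and their conjugates.
\<close>
definition Z_field :: "complex^3 \<Rightarrow> complex^3" where
  "Z_field p = vector
     [p$1 * (p$1 * cnj (p$1)) * (cnj (p$2) + cnj (p$3) - cnj (p$2) * cnj (p$3)),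
      p$1 * (p$1 * cnj (p$1)) * cnj (p$3) * (cnj (p$1) - 1 - cnj (p$1) * cnj (p$3)),
      cnj (p$2) * (cnj (p$1) + cnj (p$2) - 1)]"

lemma complex_modulus_eqn:
  "modulus_eqn p = 0 \<Longrightarrow> p$2 * cnj (p$2) = p$1 * cnj (p$1) * (p$3 * cnj (p$3))"
  unfolding modulus_eqn_def complex_norm_square[symmetric] of_real_mult[symmetric] by simp

lemma complex_real_part_eqn:
  assumes "real_part_eqn p = 0"
  shows "p$1 * cnj (p$1) * (p$3 + cnj (p$3)) =
     p$1 * cnj (p$1) + p$2 * cnj (p$2) - (p$1 + cnj (p$1)) - (p$2 + cnj (p$2)) + 1"
  using assms unfolding complex_norm_square[symmetric] complex_add_cnj
  by (simp add: real_part_eqn_def complex_eq_iff algebra_simps)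

lemma Z_field_third_nonzero: "p \<in> Xstar_reg \<Longrightarrow> Z_field p $ 3 \<noteq> 0"
proof -
  assume p: "p \<in> Xstar_reg"
  have "cnj (p$1 + p$2 - 1) \<noteq> 0" using p unfolding complex_cnj_zero_iff by (simp add: Xstar_reg_iff)
  then show "Z_field p $ 3 \<noteq> 0" using Xstar_reg_nonzero[OF p] by (simp add: Z_field_def)
qed

text \<open>
  The third component as the minor of the \<open>(v1, v2)\<close>-coefficients: the first equation replaces
  \<open>\<bar>X1\<bar>\<^sup>2 \<bar>X3\<bar>\<^sup>2\<close> by \<open>\<bar>X2\<bar>\<^sup>2\<close>, the second replaces \<open>2 \<bar>X1\<bar>\<^sup>2 Re X3\<close>, and the conjugate of \<open>z4\<close> factors out.
\<close>
lemma Z_field_third_minor: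
  assumes "p \<in> Xstar_reg"
  shows "Z_field p $ 3 = p$1 * ((cnj (p$1) * (p$3 * cnj (p$3))) * (cnj (p$2) - 1)
     + cnj (p$2) * (cnj (p$1) - 1 - cnj (p$1) * (p$3 + cnj (p$3))))"
proof -
  have eqs: "p$2 * cnj (p$2) = p$1 * cnj (p$1) * (p$3 * cnj (p$3))"
    "p$1 * cnj (p$1) * (p$3 + cnj (p$3)) =
      p$1 * cnj (p$1) + p$2 * cnj (p$2) - (p$1 + cnj (p$1)) - (p$2 + cnj (p$2)) + 1"
    using assms complex_modulus_eqn complex_real_part_eqn unfolding Xstar_reg_iff by blast+
  have "p$1 * ((cnj (p$1) * (p$3 * cnj (p$3))) * (cnj (p$2) - 1)
     + cnj (p$2) * (cnj (p$1) - 1 - cnj (p$1) * (p$3 + cnj (p$3))))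
     = (p$1 * cnj (p$1) * (p$3 * cnj (p$3))) * (cnj (p$2) - 1)
     + cnj (p$2) * (p$1 * cnj (p$1) - p$1 - p$1 * cnj (p$1) * (p$3 + cnj (p$3)))"
    by (simp add: algebra_simps)
  also have "\<dots> = Z_field p $ 3"
    unfolding eqs(1)[symmetric] eqs(2) by (simp add: Z_field_def algebra_simps)
  finally show ?thesis by simp
qed

lemma del_Z_field:
  assumes "p \<in> Xstar_reg"
  shows "del_modulus p (Z_field p) = 0" "del_real_part p (Z_field p) = 0"
proof -
  show "del_modulus p (Z_field p) = 0"
    unfolding del_modulus_def Z_field_third_minor[OF assms] by (simp add: Z_field_def algebra_simps)
  show "del_real_part p (Z_field p) = 0"
    unfolding del_real_part_def Z_field_third_minor[OF assms] by (simp add: Z_field_def algebra_simps)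
qed

text \<open>
  Subtracting the multiple of \<open>Z_field\<close> with the same third component leaves a solution
  \<open>(w1, w2, 0)\<close> of a linear \<open>2 \<times> 2\<close> system whose determinant is nonzero.
\<close>
lemma del_kernel:
  assumes p: "p \<in> Xstar_reg"
  shows "del_modulus p v = 0 \<and> del_real_part p v = 0 \<longleftrightarrow> (\<exists>c. v = c *s Z_field p)"
proof
  assume v: "del_modulus p v = 0 \<and> del_real_part p v = 0"
  define w where "w = v - (v$3 / Z_field p $ 3) *s Z_field p"
  have w3: "w$3 = 0" using Z_field_third_nonzero[OF p] by (simp add: w_def)
  have w: "del_modulus p w = 0" "del_real_part p w = 0" using v del_Z_field[OF p] by (simp_all add: w_def del_linear)
  let ?A = "cnj (p$1) * (p$3 * cnj (p$3))" and ?B = "cnj (p$2)"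
    and ?C = "cnj (p$1) - 1 - cnj (p$1) * (p$3 + cnj (p$3))" and ?D = "cnj (p$2) - 1"
  have e: "?A * w$1 - ?B * w$2 = 0" "?C * w$1 + ?D * w$2 = 0" using w w3 by (simp_all add: del_modulus_def del_real_part_def)
  have "(?A * ?D + ?B * ?C) * w$1 = ?D * (?A * w$1 - ?B * w$2) + ?B * (?C * w$1 + ?D * w$2)"
    "(?A * ?D + ?B * ?C) * w$2 = ?A * (?C * w$1 + ?D * w$2) - ?C * (?A * w$1 - ?B * w$2)"
    by (simp_all only: ring_distribs mult_ac) (simp_all add: algebra_simps)
  then have "(?A * ?D + ?B * ?C) * w$1 = 0" "(?A * ?D + ?B * ?C) * w$2 = 0" unfolding e by simp_all
  moreover have "?A * ?D + ?B * ?C \<noteq> 0"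
    using Z_field_third_nonzero[OF p] unfolding Z_field_third_minor[OF p] by auto
  ultimately have "w$1 = 0" "w$2 = 0" by (metis mult_eq_0_iff)+
  then have "w = 0" using w3 by (intro vec3_eqI) simp_all
  then show "\<exists>c. v = c *s Z_field p" unfolding w_def by (metis eq_iff_diff_eq_0)
next
  assume "\<exists>c. v = c *s Z_field p"
  then show "del_modulus p v = 0 \<and> del_real_part p v = 0" using del_Z_field[OF p] by (auto simp: del_linear)
qed

text \<open>
  Both \<open>v\<close> and \<open>- \<i> v\<close> are tangent iff the real and the imaginary parts of both \<open>(1,0)\<close>-forms vanish on \<open>v\<close>.
\<close>
lemma H_bundle_eq:
  assumes p: "p \<in> Xstar_reg"
  shows "H_bundle p = range (\<lambda>c. c *s Z_field p)" "CR_bundle Xstar_reg p = H_bundle p"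
proof -
  have "v \<in> CR_bundle Xstar_reg p \<longleftrightarrow> del_modulus p v = 0 \<and> del_real_part p v = 0" for v
  proof -
    have inv: "v = \<i> *s ((- \<i>) *s v)" "\<And>w :: complex^3. (- \<i>) *s (\<i> *s w) = w"
      by (simp_all only: vector_smult_assoc) simp_all
    have e: "v \<in> (\<lambda>X. \<i> *s X) ` tangent_space Xstar_reg p \<longleftrightarrow> (- \<i>) *s v \<in> tangent_space Xstar_reg p"
    proof
      assume "v \<in> (\<lambda>X. \<i> *s X) ` tangent_space Xstar_reg p"
      then obtain w where w: "w \<in> tangent_space Xstar_reg p" "v = \<i> *s w" by blast
      show "(- \<i>) *s v \<in> tangent_space Xstar_reg p" unfolding w(2) inv(2) by (rule w(1))
    qed (rule image_eqI[where f = "\<lambda>X. \<i> *s X", OF inv(1)])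
    have t: "(- \<i>) *s v \<in> tangent_space Xstar_reg p \<longleftrightarrow> Im (del_modulus p v) = 0 \<and> Im (del_real_part p v) = 0"
      unfolding tangent_space_iff(1)[OF p] del_linear by simp
    show ?thesis
      unfolding CR_bundle_def Int_iff e t tangent_space_iff(1)[OF p, of v] complex_eq_iff by auto
  qed
  then have "CR_bundle Xstar_reg p = range (\<lambda>c. c *s Z_field p)"
    using del_kernel[OF p] by (auto simp: image_iff)
  moreover show "CR_bundle Xstar_reg p = H_bundle p"
    unfolding H_bundle_def CR_bundle_def tangent_space_iff(2)[OF p] ..
  ultimately show "H_bundle p = range (\<lambda>c. c *s Z_field p)" by simp
qed

lemma bounded_linear_Tinv: "bounded_linear Tinv"
  unfolding Tinv_def vector_3_axis
  by (intro bounded_linear_add bounded_linear_compose[OF bounded_linear_axis]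
      bounded_linear_compose[OF bounded_linear_cnj] bounded_linear_vec_nth)

text \<open>
  Scalar multiplication transported by \<open>Tinv\<close>, which is conjugate linear in the third component.
\<close>
definition twist :: "complex \<Rightarrow> complex^3 \<Rightarrow> complex^3" where
  "twist c v = vector [c * v$1, c * v$2, cnj c * v$3]"

lemma twist_nth [simp]: "twist c v $ 1 = c * v$1" "twist c v $ 2 = c * v$2" "twist c v $ 3 = cnj c * v$3"
  by (simp_all add: twist_def)

lemma Tinv_scale: "Tinv (c *s v) = twist c (Tinv v)"
  by (rule vec3_eqI) simp_all

definition W_field :: "complex^3 \<Rightarrow> complex^3" where
  "W_field p = Tinv (Z_field (Tinv p))"

lemma V_bundle_eq:
  assumes p: "p \<in> Xstar_reg"
  shows "V_bundle p = range (\<lambda>c. twist c (W_field p))"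
proof -
  have "frechet_derivative Tinv (at (Tinv p)) = Tinv"
    using frechet_derivative_at[OF bounded_linear.has_derivative[OF bounded_linear_Tinv has_derivative_ident]] by metis
  then show ?thesis
    using H_bundle_eq(1)[of "Tinv p"] p
    by (auto simp: V_bundle_def W_field_def Tinv_scale image_image)
qed

lemma Re_del_Tinv:
  "Re (del_modulus p (Tinv v)) = Re (del_modulus (Tinv p) v)" "Re (del_real_part p (Tinv v)) = Re (del_real_part (Tinv p) v)"
  by (simp_all add: del_modulus_def del_real_part_def)

lemma twist_simps:
  "twist 0 v = 0" "twist (a + b) v = twist a v + twist b v" "twist (- b) v = - twist b v"
  by (rule vec3_eqI; simp add: algebra_simps)+

lemma twist_W_field: "twist c (W_field p) = Tinv (c *s Z_field (Tinv p))"
  by (simp add: Tinv_scale W_field_def)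

lemma W_field_third_nonzero: "p \<in> Xstar_reg \<Longrightarrow> W_field p $ 3 \<noteq> 0"
  using Z_field_third_nonzero[of "Tinv p"] by (simp add: W_field_def)

lemma Z_field_nonzero: "p \<in> Xstar_reg \<Longrightarrow> Z_field p \<noteq> 0"
  using Z_field_third_nonzero[of p] by (metis zero_index)

lemma W_field_nonzero: "p \<in> Xstar_reg \<Longrightarrow> W_field p \<noteq> 0"
  using W_field_third_nonzero[of p] by (metis zero_index)

abbreviation frame_vec :: "complex^3 \<Rightarrow> complex \<Rightarrow> complex \<Rightarrow> complex^3" where
  "frame_vec p a b \<equiv> a *s Z_field p + twist b (W_field p)"

lemma frame_tangent:
  assumes p: "p \<in> Xstar_reg"
  shows "frame_vec p a b \<in> tangent_space Xstar_reg p"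
  using del_Z_field[OF p] del_Z_field[of "Tinv p"] p
  by (simp add: tangent_space_iff(1)[OF p] del_linear twist_W_field Re_del_Tinv)

lemma tangent_eqI:
  assumes "p \<in> Xstar_reg" "v \<in> tangent_space Xstar_reg p" "w \<in> tangent_space Xstar_reg p"
    "v$1 = w$1" "v$2 = w$2"
  shows "v = w"
  using assms tangent_space_iff(1)[OF assms(1)] by (auto intro: tangent_third_determined)

text \<open>
  The vectors \<open>\<i> v\<close> and \<open>twist \<i> v\<close> have the same first two components, so if both are tangent they
  coincide, and then \<open>\<i> v3 = - \<i> v3\<close>. This gives both \<open>\<H> \<inter> \<V> = 0\<close> and \<open>\<i> \<V> \<inter> T = 0\<close>.
\<close>
lemma scale_twist_eq_0:
  assumes p: "p \<in> Xstar_reg" and eq: "\<i> *s twist b (W_field p) \<in> tangent_space Xstar_reg p"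
  shows "b = 0"
proof -
  have "\<i> *s twist b (W_field p) = twist (\<i> * b) (W_field p)"
    by (rule tangent_eqI[OF p eq]) (use frame_tangent[OF p, of 0 "\<i> * b"] in simp_all)
  from arg_cong[OF this, of "\<lambda>v. v $ 3"] show ?thesis
    using W_field_third_nonzero[OF p] by simp
qed

lemma frame_independent:
  assumes p: "p \<in> Xstar_reg" and eq: "frame_vec p a b = 0"
  shows "a = 0" "b = 0"
proof -
  have "twist b (W_field p) = (- a) *s Z_field p"
    using eq by (simp add: eq_neg_iff_add_eq_0 add.commute)
  then have "\<i> *s twist b (W_field p) = (\<i> * - a) *s Z_field p" by simp
  also have "\<dots> \<in> tangent_space Xstar_reg p"
    using frame_tangent[OF p, of "\<i> * - a" 0] by (simp add: twist_simps)
  finally show "b = 0" by (rule scale_twist_eq_0[OF p])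
  then have "a * Z_field p $ 3 = 0" using arg_cong[OF eq, of "\<lambda>v. v $ 3"] by simp
  then show "a = 0" using Z_field_third_nonzero[OF p] by simp
qed

text \<open>
  If the determinant of the first two components of \<open>Z_field\<close> and \<open>W_field\<close> vanished, some nontrivial
  \<open>frame_vec\<close> would have first two components \<open>0\<close>; being tangent it would be \<open>0\<close>, against
  \<open>frame_independent\<close>. Hence Cramer's rule solves for \<open>(v1, v2)\<close>, and the third components agree
  because both sides are tangent.
\<close>
lemma frame_spans:
  assumes p: "p \<in> Xstar_reg" and v: "v \<in> tangent_space Xstar_reg p"
  obtains a b where "v = frame_vec p a b"
proof -
  let ?Z = "Z_field p" and ?W = "W_field p"
  define d where "d = ?Z$1 * ?W$2 - ?Z$2 * ?W$1"
  have van: "a = 0 \<and> b = 0" if "a * ?Z$1 + b * ?W$1 = 0" "a * ?Z$2 + b * ?W$2 = 0" for a b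
  proof -
    have "a *s ?Z + twist b ?W = 0"
      by (rule tangent_eqI[OF p frame_tangent[OF p]])
        (use that frame_tangent[OF p, of 0 0] in \<open>simp_all add: twist_simps\<close>)
    then show ?thesis using frame_independent[OF p] by blast
  qed
  have "d \<noteq> 0"
  proof
    assume d0: "d = 0"
    \<comment> \<open>If the determinant vanishes, \<open>(W2, - Z2)\<close> and \<open>(W1, - Z1)\<close> are coefficients of linear relations.\<close>
    have "?Z$1 = 0" "?Z$2 = 0"
      using van[of "?W$2" "- ?Z$2"] van[of "?W$1" "- ?Z$1"] d0 by (auto simp: d_def algebra_simps)
    then show False using van[of 1 0] by simp
  qed
  define a b where "a = (v$1 * ?W$2 - v$2 * ?W$1) / d" and "b = (?Z$1 * v$2 - ?Z$2 * v$1) / d"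
  have "v = a *s ?Z + twist b ?W"
  proof (rule tangent_eqI[OF p v frame_tangent[OF p]])
    have ab: "d * a = v$1 * ?W$2 - v$2 * ?W$1" "d * b = ?Z$1 * v$2 - ?Z$2 * v$1"
      using \<open>d \<noteq> 0\<close> by (simp_all add: a_def b_def)
    have "d * (a * ?Z$1 + b * ?W$1) = d * v$1" "d * (a * ?Z$2 + b * ?W$2) = d * v$2"
      unfolding distrib_left mult.assoc[symmetric] ab by (simp_all add: d_def algebra_simps)
    then show "v$1 = (a *s ?Z + twist b ?W) $ 1" "v$2 = (a *s ?Z + twist b ?W) $ 2"
      using \<open>d \<noteq> 0\<close> by simp_all
  qed
  then show thesis by (rule that)
qed

text \<open>The first two components of both frame vectors are complex linear in \<open>(a, b)\<close>.\<close>
lemma tangent_cs_I_reg: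
  assumes p: "p \<in> Xstar_reg"
  shows "tangent_cs Xstar_reg I_reg p (frame_vec p a b) = frame_vec p (\<i> * a) (\<i> * b)"
proof -
  define s where "s = sgn (Im (p$3))"
  have "s = 1 \<or> s = -1" using p by (auto simp: s_def sgn_if Xstar_reg_iff)
  then have A: "(I_domain s, M_proj) \<in> I_reg" by (auto simp: I_reg_eq)
  have dom: "p \<in> I_domain s" using p by (simp add: I_domain_def s_def)
  have "bounded_linear M_proj"
    unfolding M_proj_def vector_2_axis
    by (intro bounded_linear_add bounded_linear_compose[OF bounded_linear_axis bounded_linear_vec_nth])
  then have D: "(M_proj has_derivative M_proj) (at p within I_domain s)"
    by (rule bounded_linear_imp_has_derivative)
  show ?thesis
    by (rule tangent_cs_eqI[OF complex_structure_I_reg A dom D frame_tangent[OF p] frame_tangent[OF p]])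
      (rule vec2_eqI; simp add: algebra_simps)
qed

text \<open>
  After the modulus equation is used, the difference of the two sides is \<open>X3 (1 - X3)\<close> times the
  expression whose vanishing is the real-part equation.
\<close>
lemma cross_ratio_identity:
  assumes "p \<in> Xstar_reg"
  shows "(cnj (p$2) + p$3 - cnj (p$2) * p$3) * (p$2 + p$3 - p$2 * p$3) =
     p$3 * (1 - cnj (p$1) + cnj (p$1) * p$3) * (1 - p$1 + p$1 * p$3)"
proof -
  define x x' y y' z z' where "x = p$1" and "x' = cnj x" and "y = p$2" and "y' = cnj y"
    and "z = p$3" and "z' = cnj z"
  note defs = x_def[symmetric] x'_def[symmetric] y_def[symmetric] y'_def[symmetric] z_def[symmetric] z'_def[symmetric]
  have eqs: "y * y' = x * x' * (z * z')"
    "x * x' * (z + z') = x * x' + y * y' - (x + x') - (y + y') + 1"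
    using assms complex_modulus_eqn[of p] complex_real_part_eqn[of p] unfolding Xstar_reg_iff defs by blast+
  have "(y' + z - y' * z) * (y + z - y * z) - z * (1 - x' + x' * z) * (1 - x + x * z)
      = z * (1 - z) * ((x + x') + (y + y') - 1) + (1 - z)^2 * (y * y' - z * (x * x'))"
    by (simp add: algebra_simps power2_eq_square)
  also have "\<dots> = z * (1 - z) * ((x + x') + (y + y') - 1 + x * x' * (z + z') - x * x' - x * x' * (z * z'))"
    unfolding eqs(1) by (simp add: algebra_simps power2_eq_square)
  also have "\<dots> = 0" unfolding eqs(2) by (simp add: eqs(1))
  finally show ?thesis unfolding defs by simp
qed

text \<open>The numerator of the part of \<open>dw\<close> that depends on \<open>(v1, v2)\<close>, from the quotient rule for \<open>w = z4 / z1\<close>.\<close>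
definition dw_numerator :: "complex^3 \<Rightarrow> complex^3 \<Rightarrow> complex" where
  "dw_numerator p v = (v$1 + v$2) * (p$1 + p$2 / p$3) - (p$1 + p$2 - 1) * (v$1 + v$2 / p$3)"

text \<open>
  This is where \<open>J = - I\<close> on the vertical bundle comes from. Multiplied by \<open>X3\<close>, the numerator is a
  polynomial that splits, on \<open>W_field\<close>, into a common factor and the two sides of \<open>cross_ratio_identity\<close>.
\<close>
lemma dw_numerator_W_field:
  assumes p: "p \<in> Xstar_reg"
  shows "dw_numerator p (twist b (W_field p)) = 0"
proof -
  have "p$3 \<noteq> 0" using Xstar_reg_nonzero[OF p] by simp
  then have f: "p$3 * dw_numerator p v = v$1 * (p$2 + p$3 - p$2 * p$3) + v$2 * (1 - p$1 + p$1 * p$3)" for v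
    unfolding dw_numerator_def by (simp add: field_simps)
  have W: "twist b (W_field p) $ 1 = b * (p$1 * (p$1 * cnj (p$1))) * (cnj (p$2) + p$3 - cnj (p$2) * p$3)"
    "twist b (W_field p) $ 2 = b * (p$1 * (p$1 * cnj (p$1))) * (p$3 * (cnj (p$1) - 1 - cnj (p$1) * p$3))"
    by (simp_all add: W_field_def Z_field_def)
  have "p$3 * dw_numerator p (twist b (W_field p)) = b * (p$1 * (p$1 * cnj (p$1))) *
     ((cnj (p$2) + p$3 - cnj (p$2) * p$3) * (p$2 + p$3 - p$2 * p$3)
       - p$3 * (1 - cnj (p$1) + cnj (p$1) * p$3) * (1 - p$1 + p$1 * p$3))"
    unfolding f W by (simp add: algebra_simps)
  then show ?thesis using \<open>p$3 \<noteq> 0\<close> unfolding cross_ratio_identity[OF p] by simp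
qed

lemma has_derivative_J_chart1:
  assumes p: "p \<in> Xstar_reg"
  shows "(J_chart1 has_derivative (\<lambda>v. vector [(dw_numerator p v + (p$1 + p$2 - 1) * p$2 / (p$3)\<^sup>2 * v$3) /
      (p$1 + p$2 / p$3)\<^sup>2, v$3])) (at p within Xstar_reg)"
proof (rule has_derivative_transform)
  have nz: "p$3 \<noteq> 0" "p$1 + p$2 / p$3 \<noteq> 0" using Xstar_reg_nonzero[OF p] z1_nonzero[OF p] by auto
  have nth: "((\<lambda>X. X$i) has_derivative (\<lambda>v. v$i)) (at p within Xstar_reg)" for i
    by (rule has_derivative_vec_nth[OF has_derivative_ident])
  note q = has_derivative_divide'[OF nth[of 2] nth[of 3] nz(1)]
  note n = has_derivative_diff[OF has_derivative_add[OF nth[of 1] nth[of 2]] has_derivative_const[of 1]]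
  note w = has_derivative_divide'[OF n has_derivative_add[OF nth[of 1] q] nz(2)]
  have "(J_coord has_derivative (\<lambda>v. vector [((v$1 + v$2 - 0) * (p$1 + p$2 / p$3) -
     (p$1 + p$2 - 1) * (v$1 + (v$2 * p$3 - p$2 * v$3) / (p$3 * p$3))) /
      ((p$1 + p$2 / p$3) * (p$1 + p$2 / p$3)), v$3])) (at p within Xstar_reg)"
    unfolding J_coord_def by (rule has_derivative_vector_2[OF w nth])
  moreover have "(v$1 + v$2 - 0) * (p$1 + p$2 / p$3) -
     (p$1 + p$2 - 1) * (v$1 + (v$2 * p$3 - p$2 * v$3) / (p$3 * p$3)) =
     dw_numerator p v + (p$1 + p$2 - 1) * p$2 / (p$3)\<^sup>2 * v$3" for v :: "complex^3"
  proof -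
    have q: "(v$2 * p$3 - p$2 * v$3) / (p$3 * p$3) = v$2 / p$3 - p$2 * v$3 / (p$3)\<^sup>2"
      using nz(1) by (simp add: diff_divide_distrib power2_eq_square)
    show ?thesis unfolding dw_numerator_def q by (simp add: right_diff_distrib distrib_left mult.assoc)
  qed
  ultimately show "(J_coord has_derivative (\<lambda>v. vector [(dw_numerator p v + (p$1 + p$2 - 1) * p$2 / (p$3)\<^sup>2 * v$3) /
      (p$1 + p$2 / p$3)\<^sup>2, v$3])) (at p within Xstar_reg)"
    by (simp only: power2_eq_square)
qed (use p J_chart1_eq in auto)

text \<open>
  The \<open>(v1, v2)\<close>-part of \<open>dw\<close> sees only the horizontal component, where both sides are multiplied by
  \<open>\<i>\<close>; the rest depends on \<open>v3\<close> alone, which \<open>twist (- \<i>)\<close> multiplies by \<open>\<i>\<close>.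
\<close>
lemma tangent_cs_J_reg:
  assumes p: "p \<in> Xstar_reg"
  shows "tangent_cs Xstar_reg J_reg p (frame_vec p a b) = frame_vec p (\<i> * a) (- \<i> * b)"
proof -
  have A: "(Xstar_reg, J_chart1) \<in> J_reg" by (simp add: J_reg_eq)
  have lin: "dw_numerator p (v + w) = dw_numerator p v + dw_numerator p w" "dw_numerator p (c *s v) = c * dw_numerator p v" for v w c
    by (simp_all add: dw_numerator_def add_divide_distrib algebra_simps)
  have dw: "dw_numerator p (frame_vec p (\<i> * a) (- \<i> * b)) = \<i> * dw_numerator p (frame_vec p a b)"
    unfolding lin dw_numerator_W_field[OF p] by simp
  have c3: "(frame_vec p (\<i> * a) (- \<i> * b)) $ 3 = \<i> * (frame_vec p a b) $ 3"
    by (simp add: algebra_simps)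
  have g: "(\<i> * d + k * (\<i> * c)) / m = \<i> * ((d + k * c) / m)" for d k c m :: complex
    by (simp add: algebra_simps)
  show ?thesis
  proof (rule tangent_cs_eqI[OF complex_structure_J_reg A p has_derivative_J_chart1[OF p] frame_tangent[OF p] frame_tangent[OF p]])
    show "vector [(dw_numerator p (frame_vec p (\<i> * a) (- \<i> * b)) + (p$1 + p$2 - 1) * p$2 / (p$3)\<^sup>2 *
        (frame_vec p (\<i> * a) (- \<i> * b)) $ 3) / (p$1 + p$2 / p$3)\<^sup>2,
        (frame_vec p (\<i> * a) (- \<i> * b)) $ 3] =
      \<i> *s (vector [(dw_numerator p (frame_vec p a b) + (p$1 + p$2 - 1) * p$2 / (p$3)\<^sup>2 *
        (frame_vec p a b) $ 3) / (p$1 + p$2 / p$3)\<^sup>2, (frame_vec p a b) $ 3] :: complex^2)"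
      unfolding dw c3 by (rule vec2_eqI) (simp_all only: vector_2 vector_smult_component g)
  qed
qed

section \<open>Complex line subbundles\<close>

lemma cscale_simps [simp]: "cscale 1 w = w" "cscale 0 w = 0" "cscale c 0 = 0"
  by (simp_all add: cscale_def prod_eq_iff)

lemma cscale_cscale: "cscale c (cscale d w) = cscale (c * d) w"
  by (simp add: cscale_def prod_eq_iff scaleR_left_diff_distrib scaleR_right_diff_distrib
      scaleR_left_distrib scaleR_right_distrib)

lemma cscale_eq_0_iff: "cscale c w = 0 \<longleftrightarrow> c = 0 \<or> w = 0"
proof -
  have "w = 0" if "cscale c w = 0" "c \<noteq> 0"
    using cscale_cscale[of "inverse c" c w] that by simp
  then show ?thesis by auto
qed

lemma line_subbundle:
  assumes s: "smooth_on UNIV s" and nz: "\<And>q. q \<in> M \<Longrightarrow> s q \<noteq> 0"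
    and B: "\<And>q. q \<in> M \<Longrightarrow> B q = range (\<lambda>c. cscale c (s q))"
  shows "complex_subbundle 1 M B"
  unfolding complex_subbundle_def
proof (intro ballI exI conjI allI impI)
  fix q assume q: "q \<in> M \<inter> UNIV"
  have "range (\<lambda>c::nat \<Rightarrow> complex. \<Sum>i<1. cscale (c i) (s q)) = range (\<lambda>c. cscale c (s q))"
  proof (intro equalityI subsetI)
    fix w assume "w \<in> range (\<lambda>c. cscale c (s q))"
    then obtain c where "w = cscale c (s q)" by blast
    then show "w \<in> range (\<lambda>c::nat \<Rightarrow> complex. \<Sum>i<1. cscale (c i) (s q))"
      by (intro image_eqI[of _ _ "\<lambda>_. c"]) auto
  qed auto
  then show "B q = range (\<lambda>c::nat \<Rightarrow> complex. \<Sum>i<1. cscale (c i) (s q))" using B q by simp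
  fix c :: "nat \<Rightarrow> complex" and i :: nat
  assume "(\<Sum>i<1. cscale (c i) (s q)) = 0" "i < 1"
  then show "c i = 0" using nz q by (simp add: cscale_eq_0_iff)
qed (use s in auto)

text \<open>The first frame vector of \<open>K\<close> is a nonzero element of the line, so its complex multiples fill it.\<close>
lemma subbundle_of_line:
  assumes K: "complex_subbundle r M K" "r \<ge> 1" and p: "p \<in> M"
    and sub: "K p \<subseteq> range (\<lambda>c. cscale c b)"
  shows "K p = range (\<lambda>c. cscale c b)"
proof -
  from bspec[OF K(1)[unfolded complex_subbundle_def] p] obtain U s where "p \<in> U"
    and frame: "\<forall>q\<in>M \<inter> U. K q = range (\<lambda>c. \<Sum>i<r. cscale (c i) (s i q)) \<and>
      (\<forall>c. (\<Sum>i<r. cscale (c i) (s i q)) = 0 \<longrightarrow> (\<forall>i<r. c i = 0))"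
    by (elim exE conjE)
  have s: "K p = range (\<lambda>c. \<Sum>i<r. cscale (c i) (s i p))"
    "(\<Sum>i<r. cscale (c i) (s i p)) = 0 \<Longrightarrow> (\<forall>i<r. c i = 0)" for c
    using bspec[OF frame IntI[OF p \<open>p \<in> U\<close>]] by simp_all
  have sum: "(\<Sum>i<r. cscale (if i = 0 then c else 0) (s i p)) = cscale c (s 0 p)" for c
    using K(2) by (subst sum.remove[of _ 0]) auto
  have in_K: "cscale c (s 0 p) \<in> K p" for c
    unfolding s(1) sum[symmetric] by (rule range_eqI) simp
  have "s 0 p \<noteq> 0"
  proof
    assume "s 0 p = 0"
    then have "(\<Sum>i<r. cscale (if i = 0 then 1 else 0) (s i p)) = 0" unfolding sum by simp
    from s(2)[OF this] show False using K(2) by auto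
  qed
  moreover obtain d where d: "s 0 p = cscale d b" using sub in_K[of 1] by auto
  ultimately have "d \<noteq> 0" by auto
  have "cscale c b \<in> K p" for c
    using in_K[of "c / d"] \<open>d \<noteq> 0\<close> by (simp add: d cscale_cscale)
  then show ?thesis using sub by blast
qed

text \<open>
  The \<open>(1,0)\<close>-vectors \<open>Z - \<i> I Z\<close> and \<open>W - \<i> I W\<close>, represented by their real and imaginary parts.
\<close>
definition Z10 :: "complex^3 \<Rightarrow> (complex^3) \<times> (complex^3)" where
  "Z10 p = (Z_field p, - (\<i> *s Z_field p))"

definition W10 :: "complex^3 \<Rightarrow> (complex^3) \<times> (complex^3)" where
  "W10 p = (W_field p, - twist \<i> (W_field p))"

lemma cscale_frames:
  "cscale c (Z10 p) = (c *s Z_field p, - ((\<i> * c) *s Z_field p))"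
  "cscale c (W10 p) = (twist c (W_field p), - twist (\<i> * c) (W_field p))"
  by (auto simp: cscale_def Z10_def W10_def complex_eq_iff algebra_simps intro!: vec3_eqI)

lemma bounded_linear_vector_scale: "bounded_linear (\<lambda>v. c *s v :: complex^3)"
  by (auto intro!: linear_conv_bounded_linear[THEN iffD1] linearI simp: vec_eq_iff algebra_simps)

lemma bounded_linear_twist: "bounded_linear (twist c)"
  by (auto intro!: linear_conv_bounded_linear[THEN iffD1] linearI vec3_eqI simp: algebra_simps)

lemma smooth_frames:
  "smooth_on UNIV Z_field" "smooth_on UNIV W_field" "smooth_on UNIV Z10" "smooth_on UNIV W10"
proof -
  show Z: "smooth_on UNIV Z_field" unfolding Z_field_def by (intro smooth_intros open_UNIV)
  have "smooth_on UNIV (\<lambda>p. Z_field (0 + Tinv p))"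
    by (rule smooth_on_comp_affine[OF bounded_linear_Tinv _ open_UNIV Z]) simp
  then show W: "smooth_on UNIV W_field"
    unfolding W_field_def using smooth_on_bounded_linear[OF bounded_linear_Tinv] by simp
  show "smooth_on UNIV Z10" unfolding Z10_def
    by (intro smooth_on_Pair smooth_on_minus smooth_on_bounded_linear[OF bounded_linear_vector_scale] Z)
  show "smooth_on UNIV W10" unfolding W10_def
    by (intro smooth_on_Pair smooth_on_minus smooth_on_bounded_linear[OF bounded_linear_twist] W)
qed

definition horizontal10 :: "complex^3 \<Rightarrow> ((complex^3) \<times> (complex^3)) set" where
  "horizontal10 p = range (\<lambda>c. cscale c (Z10 p))"

definition vertical10 :: "complex^3 \<Rightarrow> ((complex^3) \<times> (complex^3)) set" where
  "vertical10 p = range (\<lambda>c. cscale c (W10 p))"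

lemma subbundle_horizontal10: "complex_subbundle 1 Xstar_reg horizontal10"
  by (rule line_subbundle[OF smooth_frames(3)])
    (use Z_field_nonzero in \<open>auto simp: horizontal10_def Z10_def zero_prod_def\<close>)

lemma subbundle_vertical10: "complex_subbundle 1 Xstar_reg vertical10"
  by (rule line_subbundle[OF smooth_frames(4)])
    (use W_field_nonzero in \<open>auto simp: vertical10_def W10_def zero_prod_def\<close>)

lemma tangent_space_frame:
  "p \<in> Xstar_reg \<Longrightarrow> tangent_space Xstar_reg p = range (\<lambda>(a, b). frame_vec p a b)"
proof (intro equalityI subsetI)
  fix v assume p: "p \<in> Xstar_reg" and "v \<in> tangent_space Xstar_reg p"
  then obtain a b where "v = frame_vec p a b" by (rule frame_spans)
  then show "v \<in> range (\<lambda>(a, b). frame_vec p a b)"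
    by (intro range_eqI[of _ _ "(a, b)"]) simp
qed (auto intro: frame_tangent)

lemma T10_I_reg:
  assumes p: "p \<in> Xstar_reg"
  shows "T10 Xstar_reg I_reg p =
    range (\<lambda>(a, b). (frame_vec p a b, - (frame_vec p (\<i> * a) (\<i> * b))))"
proof -
  have "T10 Xstar_reg I_reg p = (\<lambda>X. (X, - tangent_cs Xstar_reg I_reg p X)) ` tangent_space Xstar_reg p"
    unfolding T10_def by blast
  then show ?thesis
    by (simp add: tangent_space_frame[OF p] image_image case_prod_unfold tangent_cs_I_reg[OF p])
qed

lemma T_J_reg:
  assumes p: "p \<in> Xstar_reg"
  shows "T10 Xstar_reg J_reg p =
      range (\<lambda>(a, b). (frame_vec p a b, - (frame_vec p (\<i> * a) (- \<i> * b))))"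
    "T01 Xstar_reg J_reg p =
      range (\<lambda>(a, b). (frame_vec p a b, frame_vec p (\<i> * a) (- \<i> * b)))"
proof -
  have "T10 Xstar_reg J_reg p = (\<lambda>X. (X, - tangent_cs Xstar_reg J_reg p X)) ` tangent_space Xstar_reg p"
    "T01 Xstar_reg J_reg p = (\<lambda>X. (X, tangent_cs Xstar_reg J_reg p X)) ` tangent_space Xstar_reg p"
    unfolding T10_def T01_def by blast+
  then show "T10 Xstar_reg J_reg p =
      range (\<lambda>(a, b). (frame_vec p a b, - (frame_vec p (\<i> * a) (- \<i> * b))))"
    "T01 Xstar_reg J_reg p =
      range (\<lambda>(a, b). (frame_vec p a b, frame_vec p (\<i> * a) (- \<i> * b)))"
    by (simp_all only: tangent_space_frame[OF p] image_image case_prod_unfold tangent_cs_J_reg[OF p])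
qed

section \<open>Strict pseudoconformality\<close>

lemma horizontal10_eq: "horizontal10 p = range (\<lambda>c. (c *s Z_field p, - ((\<i> * c) *s Z_field p)))"
  by (simp add: horizontal10_def cscale_frames)

lemma vertical10_eq: "vertical10 p = range (\<lambda>c. (twist c (W_field p), - twist (\<i> * c) (W_field p)))"
  by (simp add: vertical10_def cscale_frames)

lemma frame_unique:
  assumes p: "p \<in> Xstar_reg" and eq: "frame_vec p a b = frame_vec p a' b'"
  shows "a = a'" "b = b'"
proof -
  have "frame_vec p (a - a') (b - b') =
      (frame_vec p a b) - (frame_vec p a' b')"
    by (rule vec3_eqI) (simp_all add: algebra_simps)
  then have "frame_vec p (a - a') (b - b') = 0" using eq by simp
  from frame_independent[OF p this] show "a = a'" "b = b'" by simp_all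
qed

lemma range_sum_eq: "{b + c |b c. b \<in> range F \<and> c \<in> range G} = range (\<lambda>(a, b). F a + G b)"
  by (simp add: set_eq_iff image_iff split_paired_Ex) blast

text \<open>
  For \<open>X = a Z + twist b W\<close> the vectors \<open>I X\<close> and \<open>J X\<close> differ by \<open>twist (2 \<i> b) W\<close>, so they agree iff \<open>b = 0\<close>.
\<close>
lemma horizontal10_eq_Int:
  assumes p: "p \<in> Xstar_reg"
  shows "horizontal10 p = T10 Xstar_reg I_reg p \<inter> T10 Xstar_reg J_reg p"
proof (intro equalityI subsetI)
  fix w assume "w \<in> horizontal10 p"
  then obtain c where c: "w = (c *s Z_field p, - ((\<i> * c) *s Z_field p))" by (auto simp: horizontal10_eq)
  show "w \<in> T10 Xstar_reg I_reg p \<inter> T10 Xstar_reg J_reg p"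
    unfolding T10_I_reg[OF p] T_J_reg[OF p] c
    by (intro IntI; intro range_eqI[of _ _ "(c, 0)"]) (simp_all add: twist_simps)
next
  fix w assume w: "w \<in> T10 Xstar_reg I_reg p \<inter> T10 Xstar_reg J_reg p"
  then obtain a b where ab: "w = (frame_vec p a b, - (frame_vec p (\<i> * a) (\<i> * b)))"
    by (auto simp: T10_I_reg[OF p])
  from w obtain a' b' where ab': "w = (frame_vec p a' b', - (frame_vec p (\<i> * a') (- \<i> * b')))"
    by (auto simp: T_J_reg[OF p])
  have "a' = a" "b' = b" using ab ab' frame_unique[OF p, of a' b' a b] by simp_all
  then have "twist (\<i> * b) (W_field p) = twist (- \<i> * b) (W_field p)" using ab ab' by simp
  from arg_cong[OF this, of "\<lambda>v. v $ 3"] have "b = 0"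
    using W_field_third_nonzero[OF p] by simp
  then show "w \<in> horizontal10 p" unfolding horizontal10_eq ab by (intro range_eqI[of _ _ a]) (simp add: twist_simps)
qed

text \<open>Dually, \<open>I X + J X\<close> is \<open>2 \<i> a Z\<close>, which vanishes iff \<open>a = 0\<close>.\<close>
lemma vertical10_eq_Int:
  assumes p: "p \<in> Xstar_reg"
  shows "vertical10 p = T10 Xstar_reg I_reg p \<inter> T01 Xstar_reg J_reg p"
proof (intro equalityI subsetI)
  fix w assume "w \<in> vertical10 p"
  then obtain c where c: "w = (twist c (W_field p), - twist (\<i> * c) (W_field p))" by (auto simp: vertical10_eq)
  show "w \<in> T10 Xstar_reg I_reg p \<inter> T01 Xstar_reg J_reg p"
    unfolding T10_I_reg[OF p] T_J_reg[OF p] c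
    by (intro IntI; intro range_eqI[of _ _ "(0, c)"]) (simp_all add: twist_simps)
next
  fix w assume w: "w \<in> T10 Xstar_reg I_reg p \<inter> T01 Xstar_reg J_reg p"
  then obtain a b where ab: "w = (frame_vec p a b, - (frame_vec p (\<i> * a) (\<i> * b)))"
    by (auto simp: T10_I_reg[OF p])
  from w obtain a' b' where ab': "w = (frame_vec p a' b', frame_vec p (\<i> * a') (- \<i> * b'))"
    by (auto simp: T_J_reg[OF p])
  have "a' = a" "b' = b" using ab ab' frame_unique[OF p, of a' b' a b] by simp_all
  then have "2 *s ((\<i> * a) *s Z_field p) = 0" using ab ab' 
    by (auto simp: vec_eq_iff forall_3 algebra_simps)
  then have "a = 0" using Z_field_nonzero[OF p] by simp
  then show "w \<in> vertical10 p" unfolding vertical10_eq ab by (intro range_eqI[of _ _ b]) simp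
qed

lemma direct_sum_T10:
  assumes p: "p \<in> Xstar_reg"
  shows "is_direct_sum (T10 Xstar_reg I_reg p) (horizontal10 p) (vertical10 p)"
  unfolding is_direct_sum_def
proof
  show "T10 Xstar_reg I_reg p = {b + c |b c. b \<in> horizontal10 p \<and> c \<in> vertical10 p}"
    unfolding T10_I_reg[OF p] horizontal10_eq vertical10_eq range_sum_eq by simp
  have "w = 0" if w: "w \<in> horizontal10 p" "w \<in> vertical10 p" for w
  proof -
    obtain a where a: "w = (a *s Z_field p, - ((\<i> * a) *s Z_field p))" using w(1) unfolding horizontal10_eq by blast
    obtain b where b: "w = (twist b (W_field p), - twist (\<i> * b) (W_field p))" using w(2) unfolding vertical10_eq by blast
    from a b have "frame_vec p a (- b) = 0" by (simp add: twist_simps)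
    then have "a = 0" by (rule frame_independent[OF p])
    then show ?thesis using a by (simp add: zero_prod_def)
  qed
  moreover have "0 \<in> horizontal10 p" "0 \<in> vertical10 p"
    unfolding horizontal10_def vertical10_def by (auto intro!: range_eqI[of _ _ 0])
  ultimately show "horizontal10 p \<inter> vertical10 p = {0}" by blast
qed

lemma psc_structure_horizontal10: "psc_structure Xstar_reg I_reg J_reg horizontal10"
proof -
  have "K p = horizontal10 p"
    if "r \<ge> 1" "complex_subbundle r Xstar_reg K" "\<forall>p\<in>Xstar_reg. K p \<subseteq> T10 Xstar_reg I_reg p"
      "\<forall>p\<in>Xstar_reg. K p \<subseteq> T10 Xstar_reg J_reg p" "p \<in> Xstar_reg" for r K p
  proof -
    have "K p \<subseteq> range (\<lambda>c. cscale c (Z10 p))"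
      using that(3-5) horizontal10_eq_Int[of p] unfolding horizontal10_def by blast
    then show ?thesis unfolding horizontal10_def by (rule subbundle_of_line[OF that(2,1,5)])
  qed
  then show ?thesis
    unfolding psc_structure_def
    using smooth_submanifold_Xstar_reg complex_structure_I_reg complex_structure_J_reg subbundle_horizontal10 horizontal10_eq_Int
    by blast
qed

lemma spsc_structure_horizontal10_vertical10: "spsc_structure Xstar_reg I_reg J_reg horizontal10 vertical10"
  unfolding spsc_structure_def
  using psc_structure_horizontal10 subbundle_vertical10 direct_sum_T10 vertical10_eq_Int by blast

lemma spsc_structure_unique:
  assumes s: "spsc_structure Xstar_reg I_reg J_reg H V" and p: "p \<in> Xstar_reg"
  shows "H p = horizontal10 p" "V p = vertical10 p"
proof -
  from s have psc: "psc_structure Xstar_reg I_reg J_reg H" and V: "complex_subbundle 1 Xstar_reg V"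
    "V p \<subseteq> T10 Xstar_reg I_reg p \<inter> T01 Xstar_reg J_reg p"
    using p unfolding spsc_structure_def by blast+
  have H: "complex_subbundle 1 Xstar_reg H" "H p \<subseteq> T10 Xstar_reg I_reg p \<inter> T10 Xstar_reg J_reg p"
    using psc p unfolding psc_structure_def by blast+
  show "H p = horizontal10 p"
    using subbundle_of_line[OF H(1) order_refl p] H(2) unfolding horizontal10_eq_Int[OF p, symmetric] horizontal10_def by blast
  show "V p = vertical10 p"
    using subbundle_of_line[OF V(1) order_refl p] V(2) unfolding vertical10_eq_Int[OF p, symmetric] vertical10_def by blast
qed

lemma underlying_bundles:
  assumes p: "p \<in> Xstar_reg"
  shows "underlying_real horizontal10 p = H_bundle p" "underlying_real vertical10 p = V_bundle p"
  by (simp_all add: underlying_real_def horizontal10_eq vertical10_eq H_bundle_eq(1)[OF p] V_bundle_eq[OF p] image_image)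

lemma real_plane_subbundle:
  assumes s: "smooth_on UNIV s" "smooth_on UNIV t"
    and B: "\<And>q. q \<in> M \<Longrightarrow> B q = range (\<lambda>c. Re c *\<^sub>R s q + Im c *\<^sub>R t q)"
    and ind: "\<And>q c. q \<in> M \<Longrightarrow> Re c *\<^sub>R s q + Im c *\<^sub>R t q = 0 \<Longrightarrow> c = 0"
  shows "real_subbundle 2 M B"
  unfolding real_subbundle_def
proof (intro ballI)
  fix p assume "p \<in> M"
  define S where "S = (\<lambda>i::nat. if i = 0 then s else t)"
  have sum: "(\<Sum>i<2. c i *\<^sub>R S i q) = Re (Complex (c 0) (c 1)) *\<^sub>R s q + Im (Complex (c 0) (c 1)) *\<^sub>R t q"
    for c :: "nat \<Rightarrow> real" and q by (simp add: numeral_2_eq_2 S_def)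
  have "B q = range (\<lambda>c::nat \<Rightarrow> real. \<Sum>i<2. c i *\<^sub>R S i q)" if q: "q \<in> M" for q
  proof -
    have "Re c *\<^sub>R s q + Im c *\<^sub>R t q \<in> range (\<lambda>c::nat \<Rightarrow> real. \<Sum>i<2. c i *\<^sub>R S i q)" for c
      unfolding sum by (rule range_eqI[of _ _ "\<lambda>i. if i = 0 then Re c else Im c"]) simp
    moreover have "(\<Sum>i<2. c i *\<^sub>R S i q) \<in> range (\<lambda>c. Re c *\<^sub>R s q + Im c *\<^sub>R t q)" for c
      unfolding sum by (rule rangeI)
    ultimately show ?thesis unfolding B[OF q] by blast
  qed
  moreover have "c i = 0" if "q \<in> M" "(\<Sum>i<2. c i *\<^sub>R S i q) = 0" "i < 2" for q c i
    using ind[OF that(1), of "Complex (c 0) (c 1)"] that(2,3) unfolding sum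
    by (auto simp: complex_eq_iff less_2_cases_iff)
  moreover have "\<forall>i<2. smooth_on UNIV (S i)" using s by (simp add: S_def)
  ultimately show "\<exists>U s. p \<in> U \<and> open U \<and> (\<forall>i<2. smooth_on U (s i)) \<and>
        (\<forall>q\<in>M \<inter> U. B q = range (\<lambda>c::nat \<Rightarrow> real. \<Sum>i<2. c i *\<^sub>R s i q) \<and>
           (\<forall>c::nat \<Rightarrow> real. (\<Sum>i<2. c i *\<^sub>R s i q) = 0 \<longrightarrow> (\<forall>i<2. c i = 0)))"
    by (intro exI[of _ UNIV] exI[of _ S]) blast
qed

lemma real_frames:
  "Re c *\<^sub>R v + Im c *\<^sub>R (\<i> *s v) = c *s (v :: complex^3)"
  "Re c *\<^sub>R v + Im c *\<^sub>R twist \<i> v = twist c v"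
  by (auto intro!: vec3_eqI simp: complex_eq_iff)

lemma real_subbundle_H_bundle: "real_subbundle 2 Xstar_reg H_bundle"
proof (rule real_plane_subbundle[where s = Z_field and t = "\<lambda>q. \<i> *s Z_field q"])
  show "smooth_on UNIV Z_field" "smooth_on UNIV (\<lambda>q. \<i> *s Z_field q)"
    using smooth_frames(1) smooth_on_bounded_linear[OF bounded_linear_vector_scale] by blast+
qed (use H_bundle_eq(1) Z_field_nonzero in \<open>auto simp: real_frames\<close>)

lemma real_subbundle_V_bundle: "real_subbundle 2 Xstar_reg V_bundle"
proof (rule real_plane_subbundle[where s = W_field and t = "\<lambda>q. twist \<i> (W_field q)"])
  show "smooth_on UNIV W_field" "smooth_on UNIV (\<lambda>q. twist \<i> (W_field q))"
    using smooth_frames(2) smooth_on_bounded_linear[OF bounded_linear_twist] by blast+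
  show "c = 0" if "q \<in> Xstar_reg" "Re c *\<^sub>R W_field q + Im c *\<^sub>R twist \<i> (W_field q) = 0" for q c
    using that frame_independent(2)[of q 0 c] by (simp add: real_frames)
qed (use V_bundle_eq in \<open>auto simp: real_frames\<close>)

lemma antiholomorphic_Xstar_reg: "antiholomorphic_CR_submanifold Xstar_reg H_bundle V_bundle"
proof -
  have "real_subbundle 2 Xstar_reg (CR_bundle Xstar_reg)"
    using real_subbundle_H_bundle H_bundle_eq(2) unfolding real_subbundle_def by auto
  then have CR: "CR_submanifold Xstar_reg"
    unfolding CR_submanifold_def using smooth_submanifold_Xstar_reg by blast
  have "is_direct_sum (tangent_space Xstar_reg p) (H_bundle p) (V_bundle p)" if p: "p \<in> Xstar_reg" for p
    unfolding is_direct_sum_def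
  proof
    show "tangent_space Xstar_reg p = {b + c |b c. b \<in> H_bundle p \<and> c \<in> V_bundle p}"
      unfolding tangent_space_frame[OF p] H_bundle_eq(1)[OF p] V_bundle_eq[OF p] range_sum_eq ..
    have "v = 0" if v: "v \<in> H_bundle p" "v \<in> V_bundle p" for v
    proof -
      obtain a b where ab: "v = a *s Z_field p" "v = twist b (W_field p)"
        using v unfolding H_bundle_eq(1)[OF p] V_bundle_eq[OF p] by blast
      then have "frame_vec p a (- b) = 0" by (simp add: twist_simps)
      then have "a = 0" by (rule frame_independent[OF p])
      then show ?thesis using ab by simp
    qed
    moreover have "0 \<in> H_bundle p" "0 \<in> V_bundle p"
      unfolding H_bundle_eq(1)[OF p] V_bundle_eq[OF p]
      by (auto simp: twist_simps intro!: range_eqI[of _ _ 0])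
    ultimately show "H_bundle p \<inter> V_bundle p = {0}" by blast
  qed
  moreover have "(\<lambda>X. \<i> *s X) ` V_bundle p \<inter> tangent_space Xstar_reg p = {0}" if p: "p \<in> Xstar_reg" for p
  proof (intro equalityI subsetI)
    fix v assume "v \<in> (\<lambda>X. \<i> *s X) ` V_bundle p \<inter> tangent_space Xstar_reg p"
    then obtain b where "v = \<i> *s twist b (W_field p)" "\<i> *s twist b (W_field p) \<in> tangent_space Xstar_reg p"
      by (auto simp: V_bundle_eq[OF p])
    moreover from this(2) have "b = 0" by (rule scale_twist_eq_0[OF p])
    ultimately show "v \<in> {0}" by (simp add: twist_simps)
  next
    fix v :: "complex^3" assume "v \<in> {0}"
    moreover have "0 \<in> tangent_space Xstar_reg p" using frame_tangent[OF p, of 0 0] by (simp add: twist_simps)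
    moreover have "0 \<in> (\<lambda>X. \<i> *s X) ` V_bundle p"
      unfolding V_bundle_eq[OF p] image_image by (rule range_eqI[of _ _ 0]) (simp add: twist_simps)
    ultimately show "v \<in> (\<lambda>X. \<i> *s X) ` V_bundle p \<inter> tangent_space Xstar_reg p" by simp
  qed
  ultimately show ?thesis
    unfolding antiholomorphic_CR_submanifold_def
    using CR H_bundle_eq(2) real_subbundle_V_bundle by auto
qed

theorem theorem1p2:
  shows "spsc_manifold Xstar_reg I_reg J_reg \<and>
         (\<forall>H10 V10. spsc_structure Xstar_reg I_reg J_reg H10 V10 \<longrightarrow>
            (\<forall>p\<in>Xstar_reg. underlying_real H10 p = H_bundle p \<and>
                             underlying_real V10 p = V_bundle p)) \<and>
         antiholomorphic_CR_submanifold Xstar_reg H_bundle V_bundle"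
proof (intro conjI allI impI ballI)
  show "spsc_manifold Xstar_reg I_reg J_reg"
    unfolding spsc_manifold_def using spsc_structure_horizontal10_vertical10 by blast
next
  fix H V p assume *: "spsc_structure Xstar_reg I_reg J_reg H V" "p \<in> Xstar_reg"
  show "underlying_real H p = H_bundle p" "underlying_real V p = V_bundle p"
    using spsc_structure_unique[OF *] underlying_bundles[OF *(2)] unfolding underlying_real_def by simp_all
qed (rule antiholomorphic_Xstar_reg)

end
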